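(* Let $f\in\mathbb{C}[x,y]$ be a nonzero binary form of degree $6$. Then its border rank $\operatorname{brank} f$ is determined as follows. (1) $f$ has a root of multiplicity $6$ if and only if $\operatorname{brank} f=1$. (2) If $f$ has a root of multiplicity $5$, then $\operatorname{brank} f=2$. (3) If $f$ has a root of multiplicity $4$, then $\operatorname{brank} f=3$. (4) If $f$ has a root of multiplicity $3$, then $\operatorname{brank} f=4$. (5) If $f$ is stable with $I_4(f)\neq 0$, then $\operatorname{brank} f=4$. (6) If $f$ is stable with $I_4(f)=0$ and $I_2(f)^3+I_6(f)\neq 0$, then $\operatorname{brank} f=3$. (7) If $f$ is stable with $I_4(f)=0$ and $I_2(f)^3+I_6(f)=0$, then one of the following cases occurs: (a) either $I_2(f)^5-I_{10}(f)=0$, and then $\operatorname{brank} f=2$, or (b) $I_2(f)^5-I_{10}(f)\neq 0$, and then $\operatorname{brank} f=3$.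
   Context: The Waring rank of a nonzero binary form $f\in\mathbb{C}[x,y]$ of degree $d$ is the minimal $r$ such that $f=\ell_1^d+\cdots+\ell_r^d$ with $\ell_j$ linear forms. The border rank $\operatorname{brank} f$ is the smallest integer $r'$ such that $f$ lies in the closure of the set of binary forms of Waring rank $r'$ in the vector space of binary forms of degree $d$. A root of multiplicity $m$ of $f$ is a point of $\mathbb{P}^1$ at which $f$ vanishes to order exactly $m$. A binary sextic is called stable if all its roots have multiplicity at most $2$. Write a binary sextic as $$f=a_0x^6+6a_1x^5y+15a_2x^4y^2+20a_3x^3y^3+15a_4x^2y^4+6a_5xy^5+a_6y^6 .$$ Define $$I_2(f)=-10a_3^2+15a_2a_4-6a_1a_5+a_0a_6,$$ $$I_4(f)=\det\begin{pmatrix} a_0 & a_1 & a_2 & a_3 \\ a_1 & a_2 & a_3 & a_4 \\ a_2 & a_3 & a_4 & a_5 \\ a_3 & a_4 & a_5 & a_6 \end{pmatrix},$$ $$I_6(f)=\det\begin{pmatrix} b_0 & b_1 & b_2 \\ b_1 & b_2 & b_3 \\ b_2 & b_3 & b_4 \end{pmatrix},$$ where $b_0=6(a_0a_4-4a_1a_3+3a_2^2)$, $b_1=3(a_0a_5-3a_1a_4+2a_2a_3)$, $b_2=a_0a_6-9a_2a_4+8a_3^2$, $b_3=3(a_1a_6-3a_2a_5+2a_3a_4)$, $b_4=6(a_2a_6-4a_3a_5+3a_4^2)$, and $$I_{10}(f)=6^{-10}\Delta(f),$$ where $\Delta(f)=\operatorname{Res}(\partial f/\partial x,\partial f/\partial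 y)$ is the discriminant of $f$, i.e. the resultant of the two partial derivatives viewed as binary quintics, normalized by $\operatorname{Res}(x^5,y^5)=1$ (so that $I_{10}(x^6+y^6)=1$). *)

theory Defs
  imports
    "HOL-Analysis.Function_Topology"
    "HOL-Computational_Algebra.Field_as_Ring"
    "Subresultants.Resultant_Prelim"
begin

text \<open>
  The ring \<open>\<complex>[x,y]\<close> is rendered as \<open>complex poly poly = (\<complex>[x])[y]\<close>: the outer
  variable is \<open>y\<close> and the inner one is \<open>x\<close>, so that \<open>coeff (coeff f j) i\<close> is the
  coefficient of \<open>x ^ i * y ^ j\<close> in \<open>f\<close>.
\<close>

definition binary_forms :: "nat \<Rightarrow> complex poly poly set" where
  "binary_forms d = {f. \<forall>i j. coeff (coeff f j) i \<noteq> 0 \<longrightarrow> i + j = d}"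

text \<open>The form \<open>p * x + q * y\<close>.\<close>

definition linear_form :: "complex \<Rightarrow> complex \<Rightarrow> complex poly poly" where
  "linear_form p q = [:[:0, p:], [:q:]:]"

text \<open>The coefficient of \<open>x ^ (d - i) * y ^ i\<close>; it is \<open>0\<close> for \<open>i > d\<close> if \<open>f\<close> is a form of degree \<open>d\<close>.\<close>

definition form_coeff :: "nat \<Rightarrow> complex poly poly \<Rightarrow> nat \<Rightarrow> complex" where
  "form_coeff d f i = coeff (coeff f i) (d - i)"


text \<open>
  The Euclidean topology of the finite-dimensional vector space of binary forms of degree \<open>d\<close>,
  transported along the coefficient map. The topology on the function type
  \<open>nat \<Rightarrow> complex\<close> is the product topology, and the image of the coefficient map is the
  subspace of sequences supported on \<open>{..d}\<close>, a copy of \<open>\<complex>\<close> to the power \<open>d + 1\<close>.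
\<close>

definition form_topology :: "nat \<Rightarrow> complex poly poly topology" where
  "form_topology d = pullback_topology (binary_forms d) (form_coeff d) euclidean"

text \<open>
  Over the complex numbers every form of degree \<open>d \<ge> 1\<close> is a sum of \<open>d\<close>-th powers of linear
  forms, so the two minima below are taken over nonempty sets (for \<open>f \<noteq> 0\<close> in the second case).
\<close>

definition waring_rank :: "nat \<Rightarrow> complex poly poly \<Rightarrow> nat" where
  "waring_rank d f =
     (LEAST r. \<exists>l. (\<forall>j<r. l j \<in> binary_forms 1) \<and> f = (\<Sum>j<r. l j ^ d))"

definition border_rank :: "nat \<Rightarrow> complex poly poly \<Rightarrow> nat" where
  "border_rank d f =
     (LEAST r. f \<in> form_topology d closure_of
                    {g \<in> binary_forms d. g \<noteq> 0 \<and> waring_rank d g = r})"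


text \<open>
  The order of vanishing of \<open>f\<close> at the point \<open>[p : q]\<close> of the projective line, i.e. the
  multiplicity of the linear form \<open>q * x - p * y\<close> as a factor of \<open>f\<close>. Points of the projective
  line are given by homogeneous coordinates \<open>(p, q) \<noteq> (0, 0)\<close>.
\<close>

definition root_mult :: "complex poly poly \<Rightarrow> complex \<Rightarrow> complex \<Rightarrow> nat" where
  "root_mult f p q = multiplicity (linear_form q (- p)) f"

definition has_root_of_mult :: "complex poly poly \<Rightarrow> nat \<Rightarrow> bool" where
  "has_root_of_mult f m \<longleftrightarrow> (\<exists>p q. (p, q) \<noteq> (0, 0) \<and> root_mult f p q = m)"

definition stable_sextic :: "complex poly poly \<Rightarrow> bool" where
  "stable_sextic f \<longleftrightarrow> (\<forall>p q. (p, q) \<noteq> (0, 0) \<longrightarrow> root_mult f p q \<le> 2)"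


text \<open>
  The resultant of binary forms \<open>g\<close>, \<open>h\<close> of degrees \<open>m\<close>, \<open>n\<close>: the determinant of the
  Sylvester matrix of the dehomogenizations at \<open>y = 1\<close>. The matrix is built with the formal
  degrees \<open>m\<close> and \<open>n\<close>, not with the degrees of the dehomogenized polynomials, which may be
  smaller. For \<open>x ^ m\<close> and \<open>y ^ n\<close> it is the identity matrix.
\<close>

definition form_resultant ::
    "nat \<Rightarrow> nat \<Rightarrow> complex poly poly \<Rightarrow> complex poly poly \<Rightarrow> complex" where
  "form_resultant m n g h = Determinant.det (sylvester_mat_sub m n (poly g 1) (poly h 1))"

text \<open>The partial derivatives in \<open>x\<close> and \<open>y\<close> are \<open>map_poly pderiv f\<close> and \<open>pderiv f\<close>.\<close>

definition form_discriminant :: "nat \<Rightarrow> complex poly poly \<Rightarrow> complex" where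
  "form_discriminant d f = form_resultant (d - 1) (d - 1) (map_poly pderiv f) (pderiv f)"

text \<open>
  The normalized coefficients: a sextic \<open>f\<close> is the sum over \<open>i \<le> 6\<close> of
  \<open>of_nat (6 choose i) * sextic_coeff f i * x ^ (6 - i) * y ^ i\<close>.
\<close>

definition sextic_coeff :: "complex poly poly \<Rightarrow> nat \<Rightarrow> complex" where
  "sextic_coeff f i = form_coeff 6 f i / of_nat (6 choose i)"

definition I2 :: "complex poly poly \<Rightarrow> complex" where
  "I2 f = (let a = sextic_coeff f in
     - 10 * a 3 ^ 2 + 15 * a 2 * a 4 - 6 * a 1 * a 5 + a 0 * a 6)"

definition I4 :: "complex poly poly \<Rightarrow> complex" where
  "I4 f = Determinant.det (Matrix.mat 4 4 (\<lambda>(i, j). sextic_coeff f (i + j)))"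

definition I6 :: "complex poly poly \<Rightarrow> complex" where
  "I6 f = (let a = sextic_coeff f;
               b = [6 * (a 0 * a 4 - 4 * a 1 * a 3 + 3 * a 2 ^ 2),
                    3 * (a 0 * a 5 - 3 * a 1 * a 4 + 2 * a 2 * a 3),
                    a 0 * a 6 - 9 * a 2 * a 4 + 8 * a 3 ^ 2,
                    3 * (a 1 * a 6 - 3 * a 2 * a 5 + 2 * a 3 * a 4),
                    6 * (a 2 * a 6 - 4 * a 3 * a 5 + 3 * a 4 ^ 2)]
           in Determinant.det (Matrix.mat 3 3 (\<lambda>(i, j). b ! (i + j))))"

definition I10 :: "complex poly poly \<Rightarrow> complex" where
  "I10 f = form_discriminant 6 f / 6 ^ 10"

end

(* Write f by its normalized coefficients a_0, ..., a_6 and let polynomials act on sequences through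
   the shift. A form is a limit of sums of r sixth powers iff it is annihilated by a nonzero form of
   degree r: the annihilator passes to the limit by compactness, and conversely one perturbs the
   roots of the annihilator one at a time and solves a two-term recurrence for f. A root of f of
   multiplicity at least k means that a power 7 - k of a linear form annihilates f, and annihilators
   without a common factor of total degree at most 7 only annihilate 0; this settles the roots of
   multiplicity at least 3. Every sextic is annihilated by a quartic, and by a cubic iff I_4 = 0.
   A stable sextic annihilated by a cubic is a sum of three sixth powers of linear forms, where
   I_2^3 + I_6 is 54 times the product of the three mutual contributions to I_2, or is of the shape
   a l^6 + 6 b l^5 m + c m^6, where I_10 - I_2^5 = - 3125 b^6 c^4 [l, m]^30. *)

theory Submission
  imports
    Defs
    "HOL-Analysis.Function_Metric"
    "HOL-Computational_Algebra.Fundamental_Theorem_Algebra"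
begin

text \<open>The binomial normalization is what makes the shift useful: a power of px + qy has the
  coefficient sequence p^(d-i) q^i, and [:u, v:] multiplies it by up + vq while lowering d by one.
  Adjoining a power thus means solving u a_i + v a_(i+1) = b_i, and such recurrences drive both
  directions of the border rank criterion. A repeated root of the annihilator is a resonance, in
  which sums of powers with the prescribed directions do not suffice; this forces limits and
  produces the term l^5 m. The vanishing of I_2^3 + I_6 cannot separate border rank 2 from the
  tangential sextics, since it vanishes on both. The discriminant can: for independent l, m the
  difference I_10 - I_2^5 is zero exactly when bc = 0. It is found by carrying the Sylvester matrix
  over to the coordinates l, m, where it is sparse.\<close>

section \<open>Apolarity\<close>

text \<open>
  The operator \<open>c(E)\<close>, where \<open>E\<close> is the shift. On the normalized coefficients of a form of
  degree \<open>d\<close>, the polynomial \<open>[:p, q:]\<close> acts as \<open>(p \<partial>/\<partial>x + q \<partial>/\<partial>y) / d\<close>.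
\<close>

definition act :: "'a::comm_ring_1 poly \<Rightarrow> (nat \<Rightarrow> 'a) \<Rightarrow> nat \<Rightarrow> 'a" where
  "act c a j = (\<Sum>i\<le>degree c. coeff c i * a (i + j))"

text \<open>
  The polynomial \<open>c\<close> stands for a form of degree \<open>r\<close>: if \<open>degree c < r\<close>, then
  this form has a root at infinity.
\<close>

definition apolar :: "nat \<Rightarrow> nat \<Rightarrow> 'a::comm_ring_1 poly \<Rightarrow> (nat \<Rightarrow> 'a) \<Rightarrow> bool" where
  "apolar d r c a \<longleftrightarrow> (\<forall>j. j + r \<le> d \<longrightarrow> act c a j = 0)"

section \<open>The calculus of shift operators\<close>

lemma act_eq_sum:
  assumes "degree c \<le> n"
  shows "act c a j = (\<Sum>i\<le>n. coeff c i * a (i + j))"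
  unfolding act_def by (rule sum.mono_neutral_left) (use assms in \<open>auto simp: coeff_eq_0\<close>)

lemma act_0 [simp]: "act 0 a j = 0"
  by (simp add: act_def)

lemma act_pCons [simp]: "act (pCons x c) a j = x * a j + act c a (Suc j)"
proof -
  have "act (pCons x c) a j = (\<Sum>i\<le>Suc (degree c). coeff (pCons x c) i * a (i + j))"
    by (rule act_eq_sum) (simp add: degree_pCons_le)
  then show ?thesis
    by (simp add: sum.atMost_Suc_shift act_def del: sum.atMost_Suc)
qed

lemma act_1 [simp]: "act 1 a = a"
  by (rule ext) (simp add: one_pCons)

lemma act_linear: "act [:p, q:] a = (\<lambda>j. p * a j + q * a (Suc j))"
  by (rule ext) simp

lemma act_add: "act (c + c') a j = act c a j + act c' a j"
proof -
  let ?n = "max (degree c) (degree c')"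
  have "degree (c + c') \<le> ?n" by (rule degree_add_le_max)
  then show ?thesis
    by (simp add: act_eq_sum[of _ ?n] algebra_simps sum.distrib)
qed

lemma act_smult: "act (smult x c) a j = x * act c a j"
  by (simp add: act_eq_sum[of _ "degree c"] degree_smult_le sum_distrib_left mult.assoc)

lemma act_mult: "act (c * c') a = act c (act c' a)"
proof
  show "act (c * c') a j = act c (act c' a) j" for j
  proof (induction c arbitrary: j)
    case (pCons x c)
    have "act (pCons x c * c') a j = x * act c' a j + act (c * c') a (Suc j)"
      by (simp add: act_add act_smult)
    then show ?case by (simp add: pCons)
  qed simp
qed

lemma act_zero:
  assumes "degree c \<le> r" "\<And>i. j \<le> i \<Longrightarrow> i \<le> j + r \<Longrightarrow> a i = 0"
  shows "act c a j = 0"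
  unfolding act_eq_sum[OF assms(1)] by (rule sum.neutral) (auto simp: assms(2))

lemma apolar_mono: "apolar d r c a \<Longrightarrow> r \<le> r' \<Longrightarrow> apolar d r' c a"
  by (auto simp: apolar_def)

lemma apolar_mult:
  assumes "apolar d r c a" "degree c' \<le> s"
  shows "apolar d (r + s) (c * c') a"
  unfolding apolar_def
proof (intro allI impI)
  fix j assume j: "j + (r + s) \<le> d"
  have "act (c' * c) a j = 0"
    unfolding act_mult
    by (rule act_zero[OF assms(2)]) (use assms(1) j in \<open>auto simp: apolar_def\<close>)
  then show "act (c * c') a j = 0" by (simp add: mult.commute)
qed

lemma apolar_act_iff:
  "apolar d r c (act c' a) \<longleftrightarrow> apolar (d + s) (r + s) (c * c') a"
  by (auto simp: apolar_def act_mult)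

lemma apolar_act_linear:
  assumes "apolar (Suc d) r c a"
  shows "apolar d r c (act [:u, v:] a)"
proof -
  have "apolar (Suc d) (r + 1) (c * [:u, v:]) a"
    by (rule apolar_mult[OF assms]) simp
  then show ?thesis using apolar_act_iff[of d r c "[:u, v:]" a 1] by simp
qed

section \<open>Linear factors and coprime annihilators\<close>

text \<open>As a form of degree \<open>Suc r\<close>, \<open>c\<close> may have roots at infinity.
  Such a root is split off as the factor \<open>[:1, 0:]\<close>, which is 1, only once
  \<open>c\<close> is constant; before that there is a finite root.\<close>

lemma poly_root_factor:
  fixes c :: "'a::alg_closed_field poly"
  assumes "c \<noteq> 0" "degree c \<le> Suc r"
  obtains p q c' where "(p, q) \<noteq> (0, 0)" "c = [:p, q:] * c'" "c' \<noteq> 0" "degree c' \<le> r"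
proof (cases "degree c = 0")
  case True
  then have "c = [:1, 0:] * c" by (simp add: one_pCons[symmetric])
  then show ?thesis using that[of 1 0 c] assms True by simp
next
  case False
  then obtain x where "poly c x = 0"
    using alg_closed_imp_poly_has_root[of c] by auto
  then obtain c' where c': "c = [:-x, 1:] * c'" by (metis dvdE poly_eq_0_iff_dvd)
  then have "c' \<noteq> 0" using assms by auto
  then have "degree c = Suc (degree c')" unfolding c' by (subst degree_mult_eq) auto
  then show ?thesis using that[of "-x" 1 c'] c' assms \<open>c' \<noteq> 0\<close> by auto
qed

text \<open>After one step with [:p, q:] the induction gives p a_i + q a_(i+1) = 0, the other
  annihilator gives u a_i + v a_(i+1) = 0, and pv - qu is the determinant of this system for two
  neighbouring entries.\<close>

lemma act_linear_nonparallel_zero: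
  fixes a :: "nat \<Rightarrow> 'a::field"
  assumes nz: "p * v \<noteq> q * u"
    and "apolar d 1 [:u, v:] a" "apolar d k ([:p, q:] ^ k) a" "k \<le> d" "i \<le> d"
  shows "a i = 0"
  using assms(2-)
proof (induction k arbitrary: d a i)
  case 0
  then show ?case by (auto simp: apolar_def)
next
  case (Suc k)
  then obtain e where e: "d = Suc e" by (cases d) auto
  let ?b = "act [:p, q:] a"
  have "?b i = 0" if "i \<le> e" for i
  proof (rule Suc.IH[OF _ _ _ that])
    show "k \<le> e" using Suc e by simp
    show "apolar e 1 [:u, v:] ?b"
      using Suc.prems(1) e by (intro apolar_act_linear) simp
    show "apolar e k ([:p, q:] ^ k) ?b"
      using Suc.prems(2) e unfolding apolar_def
      by (auto simp only: act_mult[symmetric] power_Suc2[symmetric])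
  qed
  then have 1: "p * a i + q * a (Suc i) = 0" if "i \<le> e" for i using that by auto
  have 2: "u * a i + v * a (Suc i) = 0" if "i \<le> e" for i
    using Suc.prems(1) that e by (auto simp: apolar_def)
  have "(p * v - q * u) * a i = v * (p * a i + q * a (Suc i)) - q * (u * a i + v * a (Suc i))" for i
    by (simp add: algebra_simps)
  then have "(p * v - q * u) * a i = 0" if "i \<le> e" for i
    by (simp only: 1[OF that] 2[OF that]) simp
  then have z1: "a i = 0" if "i \<le> e" for i using that nz by simp
  have "(p * v - q * u) * a (Suc i) = p * (u * a i + v * a (Suc i)) - u * (p * a i + q * a (Suc i))" for i
    by (simp add: algebra_simps)
  then have "(p * v - q * u) * a (Suc i) = 0" if "i \<le> e" for i
    by (simp only: 1[OF that] 2[OF that]) simp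
  then have z2: "a (Suc i) = 0" if "i \<le> e" for i using that nz by simp
  show ?case using z1 z2 Suc.prems(4) e by (cases i) auto
qed

text \<open>Coprime annihilators whose degrees add up to at most d + 1 kill everything, so
  \<open>c\<close> cannot be independent of the power of [:p, q:]. The induction splits linear
  factors off \<open>c\<close>: a factor parallel to [:p, q:] is replaced by it, any other one can
  be cancelled.\<close>

lemma apolar_linear_power_le:
  fixes a :: "nat \<Rightarrow> 'a::alg_closed_field"
  assumes "(p, q) \<noteq> (0, 0)" "apolar d k ([:p, q:] ^ k) a"
    and "apolar d r c a" "c \<noteq> 0" "degree c \<le> r" "k + r \<le> Suc d"
  shows "apolar d r ([:p, q:] ^ r) a"
  using assms(2-)
proof (induction r arbitrary: c d a)
  case 0
  then obtain x where "c = [:x:]" "x \<noteq> 0" by (metis degree_0_id le_zero_eq pCons_eq_0_iff)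
  then show ?case using 0(2) by (simp add: apolar_def)
next
  case (Suc r)
  show ?case
  proof (cases "k \<le> Suc r")
    case True
    have "apolar d (k + (Suc r - k)) ([:p, q:] ^ k * [:p, q:] ^ (Suc r - k)) a"
      by (rule apolar_mult) (use Suc.prems in \<open>auto intro: order.trans[OF degree_power_le]\<close>)
    then show ?thesis using True by (simp flip: power_add)
  next
    case False
    then obtain e where e: "d = Suc e" using Suc.prems by (cases d) auto
    obtain u v c' where uv: "(u, v) \<noteq> (0, 0)" "c = [:u, v:] * c'" "c' \<noteq> 0" "degree c' \<le> r"
      using poly_root_factor Suc.prems by metis
    let ?b = "act [:u, v:] a"
    have "apolar e r ([:p, q:] ^ r) ?b"
    proof (rule Suc.IH[OF _ _ uv(3,4)])
      show "apolar e k ([:p, q:] ^ k) ?b"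
        using Suc.prems(1) e by (intro apolar_act_linear) simp
      show "apolar e r c' ?b"
        using Suc.prems(2) apolar_act_iff[of e r c' "[:u, v:]" a 1] uv e by (simp add: mult.commute)
      show "k + r \<le> Suc e" using Suc.prems e by simp
    qed
    then have *: "apolar d (Suc r) ([:p, q:] ^ r * [:u, v:]) a"
      using apolar_act_iff[of e r _ "[:u, v:]" a 1] e by simp
    show ?thesis
    proof (cases "p * v = q * u")
      case True
      then obtain t where t: "[:p, q:] = smult t [:u, v:]"
        using uv assms(1) by (cases "u = 0") (auto simp: field_simps intro: that[of "p/u"] that[of "q/v"])
      have "[:p, q:] ^ Suc r = [:p, q:] ^ r * [:p, q:]" by (rule power_Suc2)
      also have "\<dots> = smult t ([:p, q:] ^ r * [:u, v:])" by (subst (2) t) (rule mult_smult_right)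
      finally have "[:p, q:] ^ Suc r = smult t ([:p, q:] ^ r * [:u, v:])" .
      then show ?thesis using * unfolding apolar_def by (simp only: act_smult) simp
    next
      case nz: False
      \<comment> \<open>This sequence has two annihilators, the nonparallel [:u, v:] and the power k
        - r of [:p, q:], hence is zero: [:p, q:]^r alone annihilates \<open>a\<close>.\<close>
      let ?e = "act ([:p, q:] ^ r) a"
      have "?e i = 0" if "i \<le> d - r" for i
      proof (rule act_linear_nonparallel_zero[OF nz _ _ _ that])
        show "apolar (d - r) 1 [:u, v:] ?e"
          using * Suc.prems False unfolding apolar_act_iff[of _ _ _ _ a r] by (simp add: mult.commute)
        show "apolar (d - r) (k - r) ([:p, q:] ^ (k - r)) ?e"
          using Suc.prems False unfolding apolar_act_iff[of _ _ _ _ a r] by (simp flip: power_add)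
        show "k - r \<le> d - r" using Suc.prems by simp
      qed
      then have "apolar d r ([:p, q:] ^ r) a" by (auto simp: apolar_def)
      then show ?thesis using apolar_mult[of d r _ a "[:p, q:]" 1] by (simp add: mult.commute)
    qed
  qed
qed

section \<open>Binary forms and the multiplicities of their roots\<close>

text \<open>With the binomial weights, powers of linear forms get geometric coefficient sequences
  and differentiation becomes the shift. The degree is a parameter because the inductions lower
  it.\<close>

definition form :: "nat \<Rightarrow> (nat \<Rightarrow> complex) \<Rightarrow> complex poly poly" where
  "form d a = (\<Sum>i\<le>d. monom (monom (of_nat (d choose i) * a i) (d - i)) i)"

definition norm_coeff :: "nat \<Rightarrow> complex poly poly \<Rightarrow> nat \<Rightarrow> complex" where
  "norm_coeff d f i = form_coeff d f i / of_nat (d choose i)"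

lemma coeff_form:
  "coeff (coeff (form d a) j) i = (if i + j = d then of_nat (d choose j) * a j else 0)"
proof -
  have "coeff (coeff (form d a) j) i =
      (\<Sum>k\<le>d. if k = j then (if i + j = d then of_nat (d choose j) * a j else 0) else 0)"
    unfolding form_def coeff_sum by (intro sum.cong) auto
  then show ?thesis by auto
qed

lemma form_in_binary_forms [simp]: "form d a \<in> binary_forms d"
  by (auto simp: binary_forms_def coeff_form split: if_splits)

lemma form_coeff_form: "i \<le> d \<Longrightarrow> form_coeff d (form d a) i = of_nat (d choose i) * a i"
  by (simp add: form_coeff_def coeff_form)

lemma norm_coeff_form [simp]: "i \<le> d \<Longrightarrow> norm_coeff d (form d a) i = a i"
  by (simp add: norm_coeff_def form_coeff_form)

lemma form_norm_coeff:
  assumes "f \<in> binary_forms d"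
  shows "form d (norm_coeff d f) = f"
proof (intro poly_eqI)
  fix i j
  show "coeff (coeff (form d (norm_coeff d f)) j) i = coeff (coeff f j) i"
  proof (cases "i + j = d")
    case True
    then show ?thesis by (auto simp: coeff_form norm_coeff_def form_coeff_def)
  next
    case False
    then show ?thesis using assms by (auto simp: coeff_form binary_forms_def)
  qed
qed

lemma form_cong: "(\<And>i. i \<le> d \<Longrightarrow> a i = b i) \<Longrightarrow> form d a = form d b"
  unfolding form_def by (intro sum.cong) auto

lemma form_eq_iff: "form d a = form d b \<longleftrightarrow> (\<forall>i\<le>d. a i = b i)"
  using form_cong[of d a b] norm_coeff_form by metis

lemma form_zero [simp]: "form d (\<lambda>_. 0) = 0"
  by (simp add: form_def)

lemma form_eq_0_iff: "form d a = 0 \<longleftrightarrow> (\<forall>i\<le>d. a i = 0)"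
  using form_eq_iff[of d a "\<lambda>_. 0"] by simp

lemma form_add: "form d (\<lambda>i. a i + b i) = form d a + form d b"
  by (intro poly_eqI) (auto simp: coeff_form algebra_simps)

lemma form_scale: "form d (\<lambda>i. c * a i) = smult [:c:] (form d a)"
  by (intro poly_eqI) (auto simp: coeff_form)

lemma form_sum: "form d (\<lambda>i. \<Sum>k\<in>K. a k i) = (\<Sum>k\<in>K. form d (a k))"
  by (induction K rule: infinite_finite_induct) (simp_all add: form_add)

lemma form_act_linear: "form d (act [:p, q:] a) = smult [:p:] (form d a) + smult [:q:] (form d (\<lambda>i. a (Suc i)))"
  unfolding act_linear form_add form_scale ..

text \<open>Pascal's rule, or Euler's identity: up to the factor d + 1, \<open>a\<close> and its
  shift are the normalized coefficients of the partial derivatives in x and y.\<close>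

lemma form_Suc: "form (Suc d) a = [:[:0, 1:]:] * form d a + [:0, 1:] * form d (\<lambda>i. a (Suc i))"
proof (intro poly_eqI)
  fix i j
  show "coeff (coeff (form (Suc d) a) j) i
    = coeff (coeff ([:[:0, 1:]:] * form d a + [:0, 1:] * form d (\<lambda>i. a (Suc i))) j) i"
    by (cases i; cases j) (auto simp: coeff_form coeff_pCons algebra_simps)
qed

lemma linear_form_eq: "linear_form p q = smult [:p:] [:[:0, 1:]:] + smult [:q:] [:0, 1:]"
  by (simp add: linear_form_def)

lemma linear_form_mult: "linear_form p q * f = smult [:p:] ([:[:0, 1:]:] * f) + smult [:q:] ([:0, 1:] * f)"
  unfolding linear_form_eq by (simp only: distrib_right mult_smult_left)

lemma linear_form_power: "linear_form p q ^ d = form d (\<lambda>i. p ^ (d - i) * q ^ i)"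
proof (induction d)
  case 0
  show ?case by (simp add: form_def monom_0 one_pCons)
next
  case (Suc d)
  have "form (Suc d) (\<lambda>i. p ^ (Suc d - i) * q ^ i) =
     [:[:0, 1:]:] * form d (\<lambda>i. p * (p ^ (d - i) * q ^ i)) + [:0, 1:] * form d (\<lambda>i. q * (p ^ (d - i) * q ^ i))"
    unfolding form_Suc
    using form_cong[of d "\<lambda>i. p ^ (Suc d - i) * q ^ i" "\<lambda>i. p * (p ^ (d - i) * q ^ i)"]
      form_cong[of d "\<lambda>i. p ^ (Suc d - Suc i) * q ^ Suc i" "\<lambda>i. q * (p ^ (d - i) * q ^ i)"]
    by (simp add: Suc_diff_le)
  also have "\<dots> = linear_form p q * form d (\<lambda>i. p ^ (d - i) * q ^ i)"
    unfolding form_scale linear_form_mult by (simp only: mult_smult_right)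
  finally show ?case using Suc by simp
qed

lemma binary_forms_1: "binary_forms 1 = range (case_prod linear_form)"
proof (intro equalityI subsetI)
  fix f assume "f \<in> binary_forms 1"
  then have f: "form 1 (norm_coeff 1 f) = f" by (rule form_norm_coeff)
  have "form 1 (norm_coeff 1 f) = linear_form (norm_coeff 1 f 0) (norm_coeff 1 f 1)"
    by (simp add: form_def linear_form_def monom_0 monom_Suc)
  then show "f \<in> range (case_prod linear_form)"
    using f by (intro range_eqI[of _ _ "(norm_coeff 1 f 0, norm_coeff 1 f 1)"]) simp
next
  fix f assume "f \<in> range (case_prod linear_form)"
  then obtain p q where "f = linear_form p q" by auto
  then have "f = form 1 (\<lambda>i. p ^ (1 - i) * q ^ i)"
    using linear_form_power[of p q 1] by simp
  then show "f \<in> binary_forms 1" by simp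
qed

section \<open>Directional derivatives and root multiplicities\<close>

definition dir_deriv :: "complex \<Rightarrow> complex \<Rightarrow> complex poly poly \<Rightarrow> complex poly poly" where
  "dir_deriv p q f = smult [:p:] (map_poly pderiv f) + smult [:q:] (pderiv f)"

lemma map_poly_pderiv_mult:
  fixes f g :: "complex poly poly"
  shows "map_poly pderiv (f * g) = map_poly pderiv f * g + f * map_poly pderiv g"
proof (induction f)
  case (pCons c f)
  have a: "map_poly pderiv (g + h) = map_poly pderiv g + map_poly pderiv h" for g h :: "complex poly poly"
    by (intro poly_eqI) (simp add: coeff_map_poly pderiv_add)
  have s: "map_poly pderiv (smult c g) = smult (pderiv c) g + smult c (map_poly pderiv g)" for g
    by (rule poly_eqI) (simp add: coeff_map_poly pderiv_mult algebra_simps)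
  have p: "map_poly pderiv (pCons c g) = pCons (pderiv c) (map_poly pderiv g)" for c and g :: "complex poly poly"
    by (rule poly_eqI) (simp add: coeff_map_poly coeff_pCons split: nat.split)
  show ?case using pCons by (simp add: a s p)
qed simp

lemma dir_deriv_mult: "dir_deriv p q (f * g) = dir_deriv p q f * g + f * dir_deriv p q g"
  by (simp add: dir_deriv_def map_poly_pderiv_mult pderiv_mult algebra_simps smult_add_right)

lemma dir_deriv_linear_form: "dir_deriv p q (linear_form q (- p)) = 0"
proof -
  have "map_poly pderiv (linear_form q (- p)) = [:[:q:]:]"
    unfolding linear_form_def
    by (intro poly_eqI) (simp add: coeff_map_poly coeff_pCons pderiv_pCons split: nat.split)
  then show ?thesis by (simp add: dir_deriv_def linear_form_def pderiv_pCons)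
qed

lemma dir_deriv_linear_form_power:
  "dir_deriv p q (linear_form q (- p) ^ k * g) = linear_form q (- p) ^ k * dir_deriv p q g"
  by (induction k) (simp_all add: dir_deriv_mult dir_deriv_linear_form mult.assoc)

lemma dir_deriv_form:
  "dir_deriv p q (form (Suc d) a) = smult [:of_nat (Suc d):] (form d (act [:p, q:] a))"
proof (intro poly_eqI)
  fix i j
  show "coeff (coeff (dir_deriv p q (form (Suc d) a)) j) i
    = coeff (coeff (smult [:of_nat (Suc d):] (form d (act [:p, q:] a))) j) i"
  proof (cases "i + j = d")
    case True
    have "Suc d - j = Suc i" using True by simp
    then have "Suc i * (Suc d choose j) = Suc d * (d choose j)"
      using binomial_absorb_comp[of "Suc d" j] by (metis diff_Suc_1)
    moreover have "Suc j * (Suc d choose Suc j) = Suc d * (d choose j)"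
      using binomial_absorption[of j "Suc d"] by simp
    ultimately have *: "of_nat (Suc i) * of_nat (Suc d choose j) = (of_nat (Suc d) * of_nat (d choose j) :: complex)"
      "of_nat (Suc j) * of_nat (Suc d choose Suc j) = (of_nat (Suc d) * of_nat (d choose j) :: complex)"
      by (metis of_nat_mult)+
    have "coeff (coeff (dir_deriv p q (form (Suc d) a)) j) i
      = p * (of_nat (Suc i) * of_nat (Suc d choose j)) * a j + q * (of_nat (Suc j) * of_nat (Suc d choose Suc j)) * a (Suc j)"
      using True by (simp add: dir_deriv_def coeff_map_poly coeff_pderiv coeff_form of_nat_poly del: of_nat_Suc binomial_Suc_Suc)
    also have "\<dots> = coeff (coeff (smult [:of_nat (Suc d):] (form d (act [:p, q:] a))) j) i"
      unfolding * using True by (simp add: coeff_form algebra_simps del: of_nat_Suc)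
    finally show ?thesis .
  next
    case False
    then show ?thesis
      by (simp add: dir_deriv_def coeff_map_poly coeff_pderiv coeff_form of_nat_poly)
  qed
qed

text \<open>The degree in y decides unless p = 0; then the linear form is qx, a constant of the
  outer polynomial ring, and degrees in x of coefficients are compared.\<close>

lemma linear_form_power_dvd_form_Suc:
  assumes "(p, q) \<noteq> (0, 0)" "linear_form q (- p) ^ Suc d dvd form d a"
  shows "form d a = 0"
proof (rule ccontr)
  assume nz: "form d a \<noteq> 0"
  show False
  proof (cases "p = 0")
    case False
    have "degree (linear_form q (- p)) = 1" using False by (simp add: linear_form_def)
    moreover have "degree (linear_form q (- p) ^ Suc d) = Suc d * degree (linear_form q (- p))"
      using False by (subst degree_power_eq) (simp_all add: linear_form_def)
    moreover have "degree (linear_form q (- p) ^ Suc d) \<le> degree (form d a)"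
      by (rule dvd_imp_degree_le[OF assms(2) nz])
    moreover have "degree (form d a) \<le> d"
      by (rule degree_le) (auto intro!: poly_eqI simp: coeff_form)
    ultimately show False by simp
  next
    case True
    then have q: "q \<noteq> 0" using assms by simp
    have "linear_form q (- p) = [:[:0, q:]:]" by (simp add: True linear_form_def)
    then have "[:[:0, q:] ^ Suc d:] = linear_form q (- p) ^ Suc d"
      by (simp only: poly_const_pow)
    then have *: "[:0, q:] ^ Suc d dvd coeff (form d a) n" for n
      using assms(2) const_poly_dvd_iff by metis
    obtain n where n: "coeff (form d a) n \<noteq> 0" using nz by (metis leading_coeff_0_iff)
    have "degree ([:0, q:] ^ Suc d) \<le> degree (coeff (form d a) n)"
      by (rule dvd_imp_degree_le[OF * n])
    moreover have "degree ([:0, q:] ^ Suc d) = Suc d"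
      using q by (subst degree_power_eq) auto
    moreover have "degree (coeff (form d a) n) \<le> d"
      by (rule degree_le) (auto simp: coeff_form)
    ultimately show False by simp
  qed
qed

text \<open>Differentiation along (p, q) treats the linear form as a constant, so divisibility by
  its k-th power survives while the degree drops. After m steps the degree is k - 1, which leaves
  only 0.\<close>

lemma apolar_if_linear_form_power_dvd:
  assumes "(p, q) \<noteq> (0, 0)" "linear_form q (- p) ^ k dvd form d a" "k + m = Suc d"
  shows "apolar d m ([:p, q:] ^ m) a"
  using assms(2,3)
proof (induction m arbitrary: d a)
  case 0
  then have "form d a = 0" using linear_form_power_dvd_form_Suc assms(1) by simp
  then show ?case by (simp add: form_eq_0_iff apolar_def)
next
  case (Suc m)
  show ?case
  proof (cases d)
    case 0
    then show ?thesis by (simp add: apolar_def)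
  next
    case (Suc e)
    obtain g where "form d a = linear_form q (- p) ^ k * g" using Suc.prems by (elim dvdE)
    then have "smult [:of_nat d:] (form e (act [:p, q:] a)) = linear_form q (- p) ^ k * dir_deriv p q g"
      using dir_deriv_form[of p q e a] dir_deriv_linear_form_power[of p q k g] Suc by simp
    then have "smult [:1 / of_nat d:] (smult [:of_nat d:] (form e (act [:p, q:] a)))
       = linear_form q (- p) ^ k * smult [:1 / of_nat d:] (dir_deriv p q g)" by simp
    moreover have "[:1 / of_nat d:] * [:of_nat d:] = (1 :: complex poly)"
      using Suc of_nat_neq_0[of e, where 'a = complex] by (simp add: one_pCons)
    ultimately have "form e (act [:p, q:] a) = linear_form q (- p) ^ k * smult [:1 / of_nat d:] (dir_deriv p q g)"
      by (simp only: smult_smult smult_1_left)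
    then have "linear_form q (- p) ^ k dvd form e (act [:p, q:] a)" by (metis dvd_triv_left)
    then have "apolar e m ([:p, q:] ^ m) (act [:p, q:] a)"
      by (rule Suc.IH) (use Suc.prems Suc in simp)
    then show ?thesis
      using apolar_act_iff[of e m "[:p, q:] ^ m" "[:p, q:]" a 1] Suc
      by (simp only: power_Suc2[symmetric]) simp
  qed
qed

text \<open>Euler's identity recovers a form from its derivatives. By induction the derivative along
  (p, q) is divisible by the k-th power of the linear form, and all first derivatives by the power k
  - 1; the latter occur only multiplied by the linear form.\<close>

lemma linear_form_power_dvd_if_apolar:
  assumes "(p, q) \<noteq> (0, 0)" "apolar d m ([:p, q:] ^ m) a" "k + m = Suc d"
  shows "linear_form q (- p) ^ k dvd form d a"
  using assms(2,3)
proof (induction d arbitrary: a k m)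
  case 0
  show ?case
  proof (cases m)
    case 0
    then show ?thesis using "0.prems" by (simp add: apolar_def form_def)
  next
    case (Suc m')
    then show ?thesis using "0.prems" by simp
  qed
next
  case (Suc d)
  let ?l = "linear_form q (- p)" and ?z = "[:p, q:]"
  show ?case
  proof (cases m)
    case 0
    then have "form (Suc d) a = 0" using Suc.prems by (simp add: apolar_def form_eq_0_iff)
    then show ?thesis by simp
  next
    case m: (Suc m')
    show ?thesis
    proof (cases k)
      case 0
      then show ?thesis by simp
    next
      case k: (Suc k')
      have 1: "?l ^ k dvd form d (act ?z a)"
      proof (rule Suc.IH)
        show "apolar d m' (?z ^ m') (act ?z a)"
          using apolar_act_iff[of d m' "?z ^ m'" ?z a 1] Suc.prems(1) m
          by (simp only: power_Suc2[symmetric]) simp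
      qed (use Suc.prems m in simp)
      have 2: "?l ^ k' dvd form d (act [:u, v:] a)" for u v
        by (rule Suc.IH[OF apolar_act_linear[OF Suc.prems(1)]]) (use Suc.prems k in simp)
      then have 3: "?l ^ k dvd ?l * form d (act [:u, v:] a)" for u v
        unfolding k power_Suc by (intro mult_dvd_mono) auto
      have e0: "form d (act [:1, 0:] a) = form d a" "form d (act [:0, 1:] a) = form d (\<lambda>i. a (Suc i))"
        unfolding act_linear by simp_all
      have neg: "smult [:- p:] f = - smult [:p:] f" for f :: "complex poly poly"
        by (simp flip: smult_minus_left)
      \<comment> \<open>Euler's identity with qx = l + py gives \<open>eq1\<close>, with py = qx - l
        it gives \<open>eq2\<close>. At least one of the factors q, p on the left can be
        cancelled.\<close>
      have eq1: "smult [:q:] (form (Suc d) a) = ?l * form d (act [:1, 0:] a) + [:0, 1:] * form d (act ?z a)"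
        unfolding e0 form_act_linear form_Suc linear_form_mult
        by (simp add: smult_add_right neg algebra_simps)
      have eq2: "smult [:p:] (form (Suc d) a) = [:[:0, 1:]:] * form d (act ?z a) - ?l * form d (act [:0, 1:] a)"
        unfolding e0 form_act_linear form_Suc linear_form_mult
        by (simp add: smult_add_right neg algebra_simps)
      have cancel: "?l ^ k dvd f" if "?l ^ k dvd smult [:c:] f" "c \<noteq> 0" for c f
      proof -
        have "?l ^ k dvd smult [:1 / c:] (smult [:c:] f)" using that(1) by (rule dvd_smult)
        moreover have "[:1 / c:] * [:c:] = 1" using that(2) by (simp add: one_pCons)
        ultimately show ?thesis by (simp only: smult_smult smult_1_left)
      qed
      from assms(1) consider "q \<noteq> 0" | "p \<noteq> 0" by auto
      then show ?thesis
      proof cases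
        case 1
        show ?thesis
          by (rule cancel[OF _ 1], unfold eq1) (intro dvd_add 3 dvd_mult \<open>?l ^ k dvd form d (act ?z a)\<close>)
      next
        case 2
        show ?thesis
          by (rule cancel[OF _ 2], unfold eq2) (intro dvd_diff 3 dvd_mult 1)
      qed
    qed
  qed
qed

lemma linear_form_power_dvd_iff_apolar:
  assumes "(p, q) \<noteq> (0, 0)" "k \<le> Suc d"
  shows "linear_form q (- p) ^ k dvd form d a \<longleftrightarrow> apolar d (Suc d - k) ([:p, q:] ^ (Suc d - k)) a"
  using apolar_if_linear_form_power_dvd[OF assms(1), of k d a "Suc d - k"]
    linear_form_power_dvd_if_apolar[OF assms(1), of d "Suc d - k" a k] assms(2) by auto

lemma root_mult_ge_iff:
  assumes "(p, q) \<noteq> (0, 0)" "form d a \<noteq> 0" "k \<le> Suc d"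
  shows "k \<le> root_mult (form d a) p q \<longleftrightarrow> apolar d (Suc d - k) ([:p, q:] ^ (Suc d - k)) a"
proof -
  let ?l = "linear_form q (- p)"
  \<comment> \<open>\<open>multiplicity\<close> measures divisibility by powers only for a nonunit
    and a nonzero form. That the linear form is no unit is the degree bound for the constant form
    1.\<close>
  have "\<not> ?l dvd 1"
  proof
    assume "?l dvd 1"
    moreover have "form 0 (\<lambda>_. 1) = 1" by (simp add: form_def monom_0 one_pCons)
    ultimately have "?l ^ Suc 0 dvd form 0 (\<lambda>_. 1)" by simp
    then have "form 0 (\<lambda>_. 1) = 0" by (rule linear_form_power_dvd_form_Suc[OF assms(1)])
    then show False by (auto simp: form_eq_0_iff)
  qed
  then have "k \<le> root_mult (form d a) p q \<longleftrightarrow> ?l ^ k dvd form d a"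
    unfolding root_mult_def using assms(2)
    by (metis power_dvd_iff_le_multiplicity finite_divisor_powers)
  then show ?thesis using linear_form_power_dvd_iff_apolar assms by simp
qed

section \<open>Border rank and apolarity\<close>

text \<open>The directions \<open>(v k, w k)\<close> are parameters, separate from the scalars
  \<open>m k\<close>, since the recurrences and the perturbation must control them.\<close>

definition power_rep :: "nat \<Rightarrow> nat \<Rightarrow> (nat \<Rightarrow> complex) \<Rightarrow> (nat \<Rightarrow> complex) \<Rightarrow> (nat \<Rightarrow> complex) \<Rightarrow> bool" where
  "power_rep d r v w a \<longleftrightarrow> (\<exists>m. \<forall>i\<le>d. a i = (\<Sum>k<r. m k * (v k ^ (d - i) * w k ^ i)))"

definition power_sum :: "nat \<Rightarrow> nat \<Rightarrow> (nat \<Rightarrow> complex) \<Rightarrow> bool" where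
  "power_sum d r a \<longleftrightarrow> (\<exists>v w. (\<forall>k<r. (v k, w k) \<noteq> (0, 0)) \<and> power_rep d r v w a)"

lemma power_sumI:
  assumes "\<And>k. k < r \<Longrightarrow> (v k, w k) \<noteq> (0, 0)"
    and "\<And>i. i \<le> d \<Longrightarrow> a i = (\<Sum>k<r. m k * (v k ^ (d - i) * w k ^ i))"
  shows "power_sum d r a"
  unfolding power_sum_def power_rep_def
  by (intro exI[of _ v] exI[of _ w] conjI exI[of _ m]) (use assms in auto)

definition has_apolar :: "nat \<Rightarrow> nat \<Rightarrow> (nat \<Rightarrow> complex) \<Rightarrow> bool" where
  "has_apolar d r a \<longleftrightarrow> (\<exists>c. c \<noteq> 0 \<and> degree c \<le> r \<and> apolar d r c a)"

lemma has_apolar_mono: "has_apolar d r a \<Longrightarrow> r \<le> r' \<Longrightarrow> has_apolar d r' a"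
  unfolding has_apolar_def using apolar_mono by (meson order.trans)

section \<open>First-order recurrences for sums of powers\<close>

lemma act_linear_power:
  assumes "i < d"
  shows "p * (v ^ (d - i) * w ^ i) + q * (v ^ (d - Suc i) * w ^ Suc i)
    = (p * v + q * w) * (v ^ (d - Suc i) * w ^ i :: 'a::comm_ring_1)"
proof -
  have "v ^ (d - i) = v * v ^ (d - Suc i)" using assms by (metis Suc_diff_Suc power_Suc)
  then show ?thesis by (simp add: algebra_simps)
qed

lemma act_linear_eq_0_imp_power:
  fixes x :: "nat \<Rightarrow> complex"
  assumes "(p, q) \<noteq> (0, 0)" "\<And>i. i < d \<Longrightarrow> p * x i + q * x (Suc i) = 0"
  obtains l where "\<And>i. i \<le> d \<Longrightarrow> x i = l * (q ^ (d - i) * (- p) ^ i)"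
proof (cases "q = 0")
  case True
  then have p: "p \<noteq> 0" using assms by simp
  have "x i = 0" if "i < d" for i using assms(2)[OF that] True p by simp
  \<comment> \<open>For q = 0 only the last entry survives; there \<open>q ^ (d - i)\<close> is 0^0
    = 1.\<close>
  then have "x i = x d / (- p) ^ d * (q ^ (d - i) * (- p) ^ i)" if "i \<le> d" for i
    using that True p by (cases "i = d") auto
  then show ?thesis by (rule that)
next
  case False
  have "x i = x 0 / q ^ d * (q ^ (d - i) * (- p) ^ i)" if "i \<le> d" for i
    using that
  proof (induction i)
    case (Suc i)
    have "q ^ (d - i) = q * q ^ (d - Suc i)" using Suc.prems by (metis Suc_diff_Suc Suc_le_lessD power_Suc)
    then have "x i = x 0 / q ^ d * (q * q ^ (d - Suc i) * (- p) ^ i)" using Suc by simp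
    moreover have "q * x (Suc i) = - p * x i"
      using assms(2)[of i] Suc.prems by (simp add: eq_neg_iff_add_eq_0 add.commute)
    ultimately have "q * x (Suc i) = q * (x 0 / q ^ d * (q ^ (d - Suc i) * (- p) ^ Suc i))" by simp
    then show ?case by (rule mult_left_cancel[OF False, THEN iffD1])
  qed (use False in simp)
  then show ?thesis by (rule that)
qed

text \<open>A solution of the recurrence is a particular one plus a kernel element. Each power in
  \<open>y\<close> lifts after division by \<open>p * v k + q * w k\<close>, and the kernel
  contributes the new direction (q, -p).\<close>

lemma power_rep_Suc:
  assumes "power_rep e r v w y" "\<And>i. i \<le> e \<Longrightarrow> p * x i + q * x (Suc i) = y i"
    and "\<And>k. k < r \<Longrightarrow> p * v k + q * w k \<noteq> 0" "(p, q) \<noteq> (0, 0)" "v r = q" "w r = - p"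
  shows "power_rep (Suc e) (Suc r) v w x"
proof -
  obtain m where m: "\<And>i. i \<le> e \<Longrightarrow> y i = (\<Sum>k<r. m k * (v k ^ (e - i) * w k ^ i))"
    using assms(1) by (auto simp: power_rep_def)
  define m' where "m' k = m k / (p * v k + q * w k)" for k
  define s where "s i = (\<Sum>k<r. m' k * (v k ^ (Suc e - i) * w k ^ i))" for i
  have s: "p * s i + q * s (Suc i) = y i" if "i \<le> e" for i
  proof -
    have "p * s i + q * s (Suc i) = (\<Sum>k<r. m' k * (p * (v k ^ (Suc e - i) * w k ^ i) + q * (v k ^ (Suc e - Suc i) * w k ^ Suc i)))"
      unfolding s_def by (simp add: sum_distrib_left sum.distrib[symmetric] algebra_simps)
    also have "\<dots> = (\<Sum>k<r. m k * (v k ^ (e - i) * w k ^ i))"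
    proof (rule sum.cong)
      fix k assume "k \<in> {..<r}"
      then have "m' k * (p * v k + q * w k) = m k" using assms(3) by (simp add: m'_def)
      then show "m' k * (p * (v k ^ (Suc e - i) * w k ^ i) + q * (v k ^ (Suc e - Suc i) * w k ^ Suc i)) = m k * (v k ^ (e - i) * w k ^ i)"
        using act_linear_power[of i "Suc e" p "v k" "w k" q] that by (simp del: power_Suc flip: mult.assoc)
    qed simp
    finally show ?thesis using m that by simp
  qed
  have "p * (x i - s i) + q * (x (Suc i) - s (Suc i)) = 0" if "i < Suc e" for i
  proof -
    have "p * (x i - s i) + q * (x (Suc i) - s (Suc i)) = (p * x i + q * x (Suc i)) - (p * s i + q * s (Suc i))"
      by (simp add: algebra_simps)
    then show ?thesis using assms(2)[of i] s[of i] that by simp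
  qed
  then obtain l where l: "\<And>i. i \<le> Suc e \<Longrightarrow> x i - s i = l * (q ^ (Suc e - i) * (- p) ^ i)"
    by (rule act_linear_eq_0_imp_power[OF assms(4)]) blast+
  have "x i = (\<Sum>k<Suc r. (m'(r := l)) k * (v k ^ (Suc e - i) * w k ^ i))" if "i \<le> Suc e" for i
    using l[OF that] assms(5,6) by (simp add: s_def algebra_simps)
  then show ?thesis unfolding power_rep_def by blast
qed

text \<open>The direction (v, w) is killed by [:w, -v:]; applying this factor removes one summand
  and only rescales the others.\<close>

lemma power_sum_imp_has_apolar: "power_sum d r a \<Longrightarrow> has_apolar d r a"
proof (induction r arbitrary: d a)
  case 0
  then have "apolar d 0 1 a" by (auto simp: power_sum_def power_rep_def apolar_def)
  then show ?case unfolding has_apolar_def by (intro exI[of _ 1]) simp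
next
  case (Suc r)
  show ?case
  proof (cases d)
    case 0
    then have "apolar d (Suc r) 1 a" by (simp add: apolar_def)
    then show ?thesis unfolding has_apolar_def by (intro exI[of _ 1]) simp
  next
    case (Suc e)
    obtain v w m where nz: "\<And>k. k < Suc r \<Longrightarrow> (v k, w k) \<noteq> (0, 0)"
      and m: "\<And>i. i \<le> d \<Longrightarrow> a i = (\<Sum>k<Suc r. m k * (v k ^ (d - i) * w k ^ i))"
      using Suc.prems unfolding power_sum_def power_rep_def by blast
    let ?z = "[:w r, - v r:]"
    have "act ?z a i = (\<Sum>k<r. (m k * (w r * v k - v r * w k)) * (v k ^ (e - i) * w k ^ i))" if "i \<le> e" for i
    proof -
      have "act ?z a i = (\<Sum>k<Suc r. m k * (w r * (v k ^ (d - i) * w k ^ i) + (- v r) * (v k ^ (d - Suc i) * w k ^ Suc i)))"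
        unfolding act_linear using m[of i] m[of "Suc i"] that Suc
        by (simp add: sum_distrib_left sum.distrib[symmetric] sum_negf[symmetric] algebra_simps)
      also have "\<dots> = (\<Sum>k<Suc r. (m k * (w r * v k - v r * w k)) * (v k ^ (e - i) * w k ^ i))"
        using act_linear_power[of i d "w r" _ _ "- v r"] that Suc by (intro sum.cong) (simp_all add: mult.assoc)
      finally show ?thesis by simp
    qed
    then have "power_sum e r (act ?z a)"
      by (rule power_sumI[rotated]) (use nz in auto)
    then obtain c where c: "c \<noteq> 0" "degree c \<le> r" "apolar e r c (act ?z a)"
      using Suc.IH unfolding has_apolar_def by blast
    then have "apolar d (Suc r) (c * ?z) a"
      using apolar_act_iff[of e r c ?z a 1] Suc by simp
    moreover have "c * ?z \<noteq> 0" unfolding mult_eq_0_iff using c nz[of r] by auto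
    moreover have "degree (c * ?z) \<le> Suc r"
      using degree_mult_le[of c ?z] c by (auto intro: order.trans)
    ultimately show ?thesis unfolding has_apolar_def by blast
  qed
qed

section \<open>Compactness of annihilators\<close>

lemma bounded_coordinates_convergent_subseq:
  fixes u :: "nat \<Rightarrow> nat \<Rightarrow> real"
  assumes "\<And>n i. \<bar>u n i\<bar> \<le> B"
  shows "\<exists>s l. strict_mono (s :: nat \<Rightarrow> nat) \<and> (\<forall>i<r. (\<lambda>n. u (s n) i) \<longlonglongrightarrow> l i)"
proof (induction r)
  case 0
  then show ?case by (intro exI[of _ id]) (simp add: strict_mono_def)
next
  case (Suc r)
  then obtain s l where s: "strict_mono (s :: nat \<Rightarrow> nat)" "\<And>i. i < r \<Longrightarrow> (\<lambda>n. u (s n) i) \<longlonglongrightarrow> l i" by blast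
  have sc: "seq_compact (cball (0 :: real) B)" by (simp flip: compact_eq_seq_compact_metric)
  have in_ball: "\<forall>n. u (s n) r \<in> cball 0 B" using assms by simp
  obtain m t where "m \<in> cball 0 B" and t: "strict_mono t" "((\<lambda>n. u (s n) r) \<circ> t) \<longlonglongrightarrow> m"
    by (rule seq_compactE[OF sc in_ball])
  have "(\<lambda>n. u ((s \<circ> t) n) i) \<longlonglongrightarrow> (l(r := m)) i" if "i < Suc r" for i
    using that t(2) LIMSEQ_subseq_LIMSEQ[OF s(2) t(1), of i] by (cases "i = r") (auto simp: comp_def)
  then show ?case using strict_mono_o[OF s(1) t(1)] by blast
qed

lemma bounded_complex_coordinates_convergent_subseq:
  fixes u :: "nat \<Rightarrow> nat \<Rightarrow> complex"
  assumes "\<And>n i. cmod (u n i) \<le> B"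
  shows "\<exists>s l. strict_mono (s :: nat \<Rightarrow> nat) \<and> (\<forall>i<r. (\<lambda>n. u (s n) i) \<longlonglongrightarrow> l i)"
proof -
  \<comment> \<open>Even indices carry real parts and odd ones imaginary parts, which leaves 2r real
    coordinates.\<close>
  define v where "v n i = (if even i then Re (u n (i div 2)) else Im (u n (i div 2)))" for n i
  have "\<bar>v n i\<bar> \<le> B" for n i
    using abs_Re_le_cmod[of "u n (i div 2)"] abs_Im_le_cmod[of "u n (i div 2)"] assms[of n "i div 2"]
    by (auto simp: v_def)
  then obtain s l where s: "strict_mono (s :: nat \<Rightarrow> nat)"
    and l: "\<And>i. i < 2 * r \<Longrightarrow> (\<lambda>n. v (s n) i) \<longlonglongrightarrow> l i"
    using bounded_coordinates_convergent_subseq[of v B "2 * r"] by blast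
  have "(\<lambda>n. u (s n) i) \<longlonglongrightarrow> Complex (l (2 * i)) (l (2 * i + 1))" if "i < r" for i
    using l[of "2 * i"] l[of "2 * i + 1"] that by (simp add: tendsto_complex_iff v_def)
  then show ?thesis using s by (intro exI[of _ s] exI[of _ "\<lambda>i. Complex (l (2 * i)) (l (2 * i + 1))"]) simp
qed

lemma has_apolar_closed:
  assumes "\<And>n. has_apolar d r (x n)" "\<And>i. i \<le> d \<Longrightarrow> (\<lambda>n. x n i) \<longlonglongrightarrow> a i"
  shows "has_apolar d r a"
proof -
  obtain c where c: "\<And>n. c n \<noteq> 0" "\<And>n. degree (c n) \<le> r" "\<And>n. apolar d r (c n) (x n)"
    using assms(1) unfolding has_apolar_def by metis
  \<comment> \<open>Division by the sum of the moduli puts the coefficient vectors on a compact unit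
    sphere, so the limit annihilator is nonzero. Its degree may drop, which is why annihilators are
    only asked to have degree at most r.\<close>
  define M where "M n = (\<Sum>i\<le>r. cmod (coeff (c n) i))" for n
  have M: "M n > 0" for n
  proof -
    have "cmod (coeff (c n) (degree (c n))) \<le> M n"
      unfolding M_def by (rule member_le_sum) (use c in auto)
    then show ?thesis using c(1)[of n] by (meson leading_coeff_neq_0 order_less_le_trans zero_less_norm_iff)
  qed
  define u where "u n i = (if i \<le> r then coeff (c n) i / of_real (M n) else 0)" for n i
  have norm_u: "cmod (u n i) = (if i \<le> r then cmod (coeff (c n) i) / M n else 0)" for n i
    using M[of n] by (simp add: u_def norm_divide)
  have "cmod (u n i) \<le> 1" for n i
  proof (cases "i \<le> r")
    case True
    then have "cmod (coeff (c n) i) \<le> M n" unfolding M_def by (intro member_le_sum) auto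
    then show ?thesis using M[of n] True by (simp add: norm_u)
  qed (simp add: norm_u)
  then obtain s l where s: "strict_mono (s :: nat \<Rightarrow> nat)" and l: "\<And>i. i < Suc r \<Longrightarrow> (\<lambda>n. u (s n) i) \<longlonglongrightarrow> l i"
    using bounded_complex_coordinates_convergent_subseq[of u 1 "Suc r"] by blast
  define c' where "c' = (\<Sum>i\<le>r. monom (l i) i)"
  have coeff: "coeff c' i = (if i \<le> r then l i else 0)" for i
    unfolding c'_def by (simp add: coeff_sum)
  have "(\<Sum>i\<le>r. cmod (u n i)) = (\<Sum>i\<le>r. cmod (coeff (c n) i)) / M n" for n
    by (simp add: norm_u sum_divide_distrib)
  then have "(\<Sum>i\<le>r. cmod (u n i)) = 1" for n
    using M[of n] by (simp add: M_def[symmetric])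
  moreover have "(\<lambda>n. \<Sum>i\<le>r. cmod (u (s n) i)) \<longlonglongrightarrow> (\<Sum>i\<le>r. cmod (l i))"
    by (intro tendsto_sum tendsto_norm l) simp
  ultimately have "(\<Sum>i\<le>r. cmod (l i)) = 1" by (simp add: LIMSEQ_const_iff)
  then have "c' \<noteq> 0" using coeff by (metis (mono_tags, lifting) atMost_iff coeff_0 norm_zero sum.neutral zero_neq_one)
  moreover have deg: "degree c' \<le> r" by (rule degree_le) (simp add: coeff)
  moreover have "apolar d r c' a"
    unfolding apolar_def
  proof (intro allI impI)
    fix j assume j: "j + r \<le> d"
    have "(\<Sum>i\<le>r. u n i * x n (i + j)) = 0" for n
    proof -
      have "(\<Sum>i\<le>r. u n i * x n (i + j)) = act (c n) (x n) j / of_real (M n)"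
        unfolding act_eq_sum[OF c(2)] by (simp add: u_def sum_divide_distrib)
      then show ?thesis using c(3)[of n] j by (simp add: apolar_def)
    qed
    moreover have "(\<lambda>n. \<Sum>i\<le>r. u (s n) i * x (s n) (i + j)) \<longlonglongrightarrow> (\<Sum>i\<le>r. l i * a (i + j))"
      using j by (intro tendsto_sum tendsto_mult l LIMSEQ_subseq_LIMSEQ[OF assms(2) s, unfolded comp_def]) auto
    ultimately have "(\<Sum>i\<le>r. l i * a (i + j)) = 0" by (simp add: LIMSEQ_const_iff)
    then show "act c' a j = 0" by (simp add: act_eq_sum[OF deg] coeff)
  qed
  ultimately show ?thesis unfolding has_apolar_def by blast
qed

section \<open>Limits of sums of powers\<close>

definition power_sum_limit :: "nat \<Rightarrow> nat \<Rightarrow> (nat \<Rightarrow> complex) \<Rightarrow> bool" where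
  "power_sum_limit d r a \<longleftrightarrow>
     (\<exists>x. (\<forall>n. power_sum d r (x n)) \<and> (\<forall>i\<le>d. (\<lambda>n. x n i) \<longlonglongrightarrow> a i))"

text \<open>Reversal exchanges x and y. It moves a root of the annihilator from infinity to a finite
  place, where the recurrence can be solved forwards.\<close>

lemma power_sum_reverse: "power_sum d r a \<Longrightarrow> power_sum d r (\<lambda>i. a (d - i))"
proof -
  assume "power_sum d r a"
  then obtain v w m where nz: "\<And>k. k < r \<Longrightarrow> (v k, w k) \<noteq> (0, 0)"
    and m: "\<And>i. i \<le> d \<Longrightarrow> a i = (\<Sum>k<r. m k * (v k ^ (d - i) * w k ^ i))"
    unfolding power_sum_def power_rep_def by blast
  have "a (d - i) = (\<Sum>k<r. m k * (w k ^ (d - i) * v k ^ i))" if "i \<le> d" for i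
    using m[of "d - i"] that by (simp add: mult.commute)
  moreover have "(w k, v k) \<noteq> (0, 0)" if "k < r" for k using nz[OF that] by auto
  ultimately show ?thesis by (intro power_sumI)
qed

lemma power_sum_limit_reverse:
  assumes "power_sum_limit d r a"
  shows "power_sum_limit d r (\<lambda>i. a (d - i))"
proof -
  obtain x where x: "\<And>n. power_sum d r (x n)" "\<And>i. i \<le> d \<Longrightarrow> (\<lambda>n. x n i) \<longlonglongrightarrow> a i"
    using assms unfolding power_sum_limit_def by blast
  then show ?thesis unfolding power_sum_limit_def
    by (intro exI[of _ "\<lambda>n i. x n (d - i)"]) (auto intro: power_sum_reverse)
qed

lemma power_sum_limit_cong:
  assumes "\<And>i. i \<le> d \<Longrightarrow> a i = b i"
  shows "power_sum_limit d r a \<longleftrightarrow> power_sum_limit d r b"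
  using assms by (simp add: power_sum_limit_def)

text \<open>
  Perturbing the root \<open>[p : q]\<close> keeps it away from the directions that occur in the
  approximating sums of powers, so that \<open>power_rep_Suc\<close> applies.
\<close>

lemma power_sum_limit_Suc:
  assumes "q \<noteq> 0" "power_sum_limit e r b" and ab: "\<And>i. i \<le> e \<Longrightarrow> p * a i + q * a (Suc i) = b i"
  shows "power_sum_limit (Suc e) (Suc r) a"
proof -
  obtain y where y: "\<And>n. power_sum e r (y n)" "\<And>i. i \<le> e \<Longrightarrow> (\<lambda>n. y n i) \<longlonglongrightarrow> b i"
    using assms(2) unfolding power_sum_limit_def by blast
  obtain v w where nz: "\<And>n k. k < r \<Longrightarrow> (v n k, w n k) \<noteq> (0, 0)"
    and rep: "\<And>n. power_rep e r (v n) (w n) (y n)"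
    using y(1) unfolding power_sum_def by metis
  have "\<exists>p'. dist p' p < 1 / Suc n \<and> (\<forall>k<r. p' * v n k + q * w n k \<noteq> 0)" for n
  proof -
    \<comment> \<open>The finitely many p' for which [:p', q:] kills an old direction. If
      \<open>v n k = 0\<close> there is none, since \<open>w n k\<close> and q are nonzero, and the
      default value of the division does no harm.\<close>
    define bad where "bad = (\<lambda>k. - (q * w n k) / v n k) ` {..<r}"
    have "infinite (ball p (1 / Suc n))"
      using islimpt_UNIV[of p] unfolding islimpt_eq_infinite_ball by auto
    then have "infinite (ball p (1 / Suc n) - bad)"
      by (rule Diff_infinite_finite[rotated]) (simp add: bad_def)
    then obtain p' where p': "p' \<in> ball p (1 / Suc n)" "p' \<notin> bad"
      by (metis DiffE finite.emptyI ex_in_conv)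
    have "p' * v n k + q * w n k \<noteq> 0" if "k < r" for k
    proof
      assume eq: "p' * v n k + q * w n k = 0"
      show False
      proof (cases "v n k = 0")
        case True
        then show False using eq nz[OF that, of n] assms(1) by simp
      next
        case False
        then have "p' = - (q * w n k) / v n k" using eq by (simp add: field_simps eq_neg_iff_add_eq_0)
        then show False using p'(2) that by (auto simp: bad_def)
      qed
    qed
    then show ?thesis using p' by (auto simp: dist_commute)
  qed
  then obtain P where P: "\<And>n. dist (P n) p < 1 / Suc n"
    and nonorth: "\<And>n k. k < r \<Longrightarrow> P n * v n k + q * w n k \<noteq> 0" by metis
  have limP: "P \<longlonglongrightarrow> p"
  proof (rule tendstoI)
    fix e :: real assume "e > 0"
    then obtain N where N: "1 / Suc N < e" using nat_approx_posE by (metis of_nat_Suc)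
    have "dist (P n) p < e" if "n \<ge> N" for n
    proof -
      have "1 / Suc n \<le> 1 / Suc N" using that by (intro divide_left_mono) auto
      then show ?thesis using P[of n] N by linarith
    qed
    then show "eventually (\<lambda>n. dist (P n) p < e) sequentially"
      unfolding eventually_sequentially by blast
  qed
  \<comment> \<open>The perturbed recurrence is solved forwards from the exact entry
    \<open>a 0\<close>, so by continuity each entry converges to that of \<open>a\<close>.\<close>
  define x where "x n = rec_nat (a 0) (\<lambda>i X. (y n i - P n * X) / q)" for n
  have x0: "x n 0 = a 0" and xS: "x n (Suc i) = (y n i - P n * x n i) / q" for n i
    by (simp_all add: x_def)
  have "power_sum (Suc e) (Suc r) (x n)" for n
  proof -
    let ?v = "(v n)(r := q)" and ?w = "(w n)(r := - P n)"
    have rep': "power_rep e r ?v ?w (y n)"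
      using rep[of n] unfolding power_rep_def by simp
    have "power_rep (Suc e) (Suc r) ?v ?w (x n)"
      by (rule power_rep_Suc[OF rep', of "P n" _ q]) (use nonorth assms(1) in \<open>auto simp: xS\<close>)
    moreover have "(?v k, ?w k) \<noteq> (0, 0)" if "k < Suc r" for k
      using that nz[of k n] assms(1) by (cases "k = r") auto
    ultimately show ?thesis unfolding power_sum_def by blast
  qed
  moreover have "(\<lambda>n. x n i) \<longlonglongrightarrow> a i" if "i \<le> Suc e" for i
    using that
  proof (induction i)
    case (Suc i)
    then have "(\<lambda>n. (y n i - P n * x n i) / q) \<longlonglongrightarrow> (b i - p * a i) / q"
      by (intro tendsto_divide tendsto_diff tendsto_mult y(2) limP tendsto_const) (use assms(1) in auto)
    moreover have "(b i - p * a i) / q = a (Suc i)"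
      using ab[of i] Suc.prems assms(1) by (simp add: field_simps)
    ultimately show ?case by (simp add: xS)
  qed (simp add: x0)
  ultimately show ?thesis unfolding power_sum_limit_def by blast
qed

lemma has_apolar_imp_power_sum_limit: "has_apolar d r a \<Longrightarrow> power_sum_limit d r a"
proof (induction r arbitrary: d a)
  case 0
  then obtain c where c: "c \<noteq> 0" "degree c = 0" "apolar d 0 c a" unfolding has_apolar_def by auto
  then obtain x where "c = [:x:]" "x \<noteq> 0" by (metis degree_0_id pCons_eq_0_iff)
  then have "\<forall>i\<le>d. a i = 0" using c by (simp add: apolar_def)
  moreover have "power_sum d 0 (\<lambda>_. 0)" by (simp add: power_sum_def power_rep_def)
  ultimately show ?case unfolding power_sum_limit_def by (intro exI[of _ "\<lambda>_ _. 0"]) simp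
next
  case (Suc r)
  show ?case
  proof (cases d)
    case 0
    have "power_sum 0 (Suc r) a"
      unfolding power_sum_def power_rep_def
      by (intro exI[of _ "\<lambda>_. 1"] conjI exI[of _ "\<lambda>k. if k = 0 then a 0 else 0"]) (auto simp: sum.delta)
    then show ?thesis using 0 unfolding power_sum_limit_def by (intro exI[of _ "\<lambda>_. a"]) simp
  next
    case d: (Suc e)
    obtain c where c: "c \<noteq> 0" "degree c \<le> Suc r" "apolar d (Suc r) c a"
      using Suc.prems unfolding has_apolar_def by blast
    obtain p q c' where z: "(p, q) \<noteq> (0, 0)" "c = [:p, q:] * c'" "c' \<noteq> 0" "degree c' \<le> r"
      using poly_root_factor c by metis
    let ?b = "act [:p, q:] a"
    have "apolar e r c' ?b"
      using apolar_act_iff[of e r c' "[:p, q:]" a 1] c z d by (simp add: mult.commute)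
    then have b: "power_sum_limit e r ?b" using Suc.IH z unfolding has_apolar_def by blast
    show ?thesis
    proof (cases "q = 0")
      case False
      then show ?thesis using power_sum_limit_Suc[OF False b, of p a] d by simp
    next
      \<comment> \<open>For q = 0 the recurrence does not determine \<open>a (Suc i)\<close>. Under
        reversal p and q change places, and p is nonzero.\<close>
      case True
      then have "p \<noteq> 0" using z by simp
      then have "power_sum_limit (Suc e) (Suc r) (\<lambda>i. a (Suc e - i))"
        by (rule power_sum_limit_Suc[OF _ power_sum_limit_reverse[OF b], of p q]) (simp add: True Suc_diff_le)
      from power_sum_limit_reverse[OF this] show ?thesis
        using power_sum_limit_cong[of "Suc e" "\<lambda>i. a (Suc e - (Suc e - i))" a] d by simp
    qed
  qed
qed

section \<open>Sums of powers and the Waring rank\<close>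

text \<open>The d + 1 directions (1, k) are pairwise independent, so their powers span all forms, as
  with Vandermonde's determinant. Hence the minimum in the Waring rank is attained.\<close>

lemma power_rep_of_nat: "power_rep d (Suc d) (\<lambda>_. 1) of_nat a"
proof (induction d arbitrary: a)
  case 0
  show ?case unfolding power_rep_def by (intro exI[of _ a]) simp
next
  case (Suc d)
  show ?case
  proof (rule power_rep_Suc[OF Suc.IH])
    fix k assume "k < Suc d"
    then have "of_nat k \<noteq> (of_nat (Suc d) :: complex)" by (metis less_irrefl of_nat_eq_iff)
    moreover have "- x * 1 + 1 * y \<noteq> 0" if "y \<noteq> x" for x y :: complex
      using that by (simp add: add_eq_0_iff)
    ultimately show "- of_nat (Suc d) * 1 + 1 * of_nat k \<noteq> (0 :: complex)" by blast
  qed auto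
qed

lemma power_sum_exists: "\<exists>r. power_sum d r a"
  unfolding power_sum_def using power_rep_of_nat[of d a]
  by (intro exI[of _ "Suc d"] exI[of _ "\<lambda>_. 1"] exI[of _ of_nat]) simp

text \<open>Complex d-th roots of the scalars turn multiples of powers into powers.\<close>

lemma power_sum_imp_sum_of_powers:
  assumes "power_sum d r a" "d > 0"
  shows "\<exists>l. (\<forall>j<r. l j \<in> binary_forms 1) \<and> form d a = (\<Sum>j<r. l j ^ d)"
proof -
  obtain v w m where m: "\<And>i. i \<le> d \<Longrightarrow> a i = (\<Sum>k<r. m k * (v k ^ (d - i) * w k ^ i))"
    using assms(1) unfolding power_sum_def power_rep_def by blast
  have "\<forall>k. \<exists>y. y ^ d = m k" using nth_root_exists[OF assms(2)] by blast
  then obtain t where t: "\<And>k. t k ^ d = m k" by metis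
  define l where "l k = linear_form (t k * v k) (t k * w k)" for k
  have "form d a = form d (\<lambda>i. \<Sum>k<r. (t k * v k) ^ (d - i) * (t k * w k) ^ i)"
  proof (rule form_cong)
    fix i assume i: "i \<le> d"
    have "m k = t k ^ (d - i) * t k ^ i" for k using i by (simp add: t flip: power_add)
    then show "a i = (\<Sum>k<r. (t k * v k) ^ (d - i) * (t k * w k) ^ i)"
      unfolding m[OF i] by (intro sum.cong) (simp_all add: power_mult_distrib)
  qed
  also have "\<dots> = (\<Sum>k<r. l k ^ d)" by (simp add: form_sum l_def linear_form_power)
  finally show ?thesis using binary_forms_1 by (intro exI[of _ l]) (auto simp: l_def)
qed

lemma sum_of_powers_imp_power_sum:
  assumes "\<And>j. j < r \<Longrightarrow> l j \<in> binary_forms 1" "d > 0"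
  shows "power_sum d r (norm_coeff d (\<Sum>j<r. l j ^ d))"
proof -
  have "\<exists>p q. l j = linear_form p q" if "j < r" for j using assms(1)[OF that] binary_forms_1 by auto
  then obtain v w where vw: "\<And>j. j < r \<Longrightarrow> l j = linear_form (v j) (w j)" by metis
  have e: "(\<Sum>j<r. l j ^ d) = form d (\<lambda>i. \<Sum>j<r. v j ^ (d - i) * w j ^ i)"
    unfolding form_sum by (rule sum.cong) (simp_all add: vw linear_form_power)
  \<comment> \<open>A zero linear form has no direction; it is replaced by the direction (1, 0) with
    scalar 0, which is correct because its d-th power is 0 for d > 0.\<close>
  define Z where "Z k \<longleftrightarrow> v k = 0 \<and> w k = 0" for k
  have "norm_coeff d (\<Sum>j<r. l j ^ d) i =
      (\<Sum>k<r. (if Z k then 0 else 1) * ((if Z k then 1 else v k) ^ (d - i) * w k ^ i))" if "i \<le> d" for i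
    unfolding e norm_coeff_form[OF that]
    by (intro sum.cong) (use assms(2) in \<open>auto simp: Z_def power_0_left\<close>)
  moreover have "((if Z k then 1 else v k), w k) \<noteq> (0, 0)" for k by (auto simp: Z_def)
  ultimately show ?thesis by (intro power_sumI)
qed

lemma waring_rank_le:
  assumes "power_sum d r (norm_coeff d f)" "d > 0" "f \<in> binary_forms d"
  shows "waring_rank d f \<le> r"
  unfolding waring_rank_def
  using power_sum_imp_sum_of_powers[OF assms(1,2)] form_norm_coeff[OF assms(3)] by (auto intro: Least_le)

lemma power_sum_waring_rank:
  assumes "d > 0" "f \<in> binary_forms d"
  shows "power_sum d (waring_rank d f) (norm_coeff d f)"
proof -
  obtain r where "power_sum d r (norm_coeff d f)" using power_sum_exists by blast
  from power_sum_imp_sum_of_powers[OF this assms(1)]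
  have "\<exists>(r :: nat) l. (\<forall>j<r. l j \<in> binary_forms 1) \<and> f = (\<Sum>j<r. l j ^ d)"
    unfolding form_norm_coeff[OF assms(2)] by (rule exI)
  then have "\<exists>l. (\<forall>j<waring_rank d f. l j \<in> binary_forms 1) \<and> f = (\<Sum>j<waring_rank d f. l j ^ d)"
    unfolding waring_rank_def by (rule LeastI_ex)
  then obtain l where l: "\<And>j. j < waring_rank d f \<Longrightarrow> l j \<in> binary_forms 1"
    "f = (\<Sum>j<waring_rank d f. l j ^ d)" by blast
  have "power_sum d (waring_rank d f) (norm_coeff d (\<Sum>j<waring_rank d f. l j ^ d))"
    by (rule sum_of_powers_imp_power_sum[OF _ assms(1)]) (rule l(1))
  then show ?thesis unfolding l(2)[symmetric] .
qed

section \<open>Closures in the space of forms\<close>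

lemma tendsto_sequence_iff:
  fixes x :: "'a \<Rightarrow> nat \<Rightarrow> complex"
  shows "(x \<longlongrightarrow> a) F \<longleftrightarrow> (\<forall>i. ((\<lambda>n. x n i) \<longlongrightarrow> a i) F)"
  using limitin_componentwise[of "\<lambda>_. euclidean" UNIV x a F]
  by (simp add: euclidean_product_topology)

lemma tendsto_norm_coeff_iff:
  assumes "i \<le> d"
  shows "(\<lambda>n. norm_coeff d (g n) i) \<longlonglongrightarrow> norm_coeff d f i
     \<longleftrightarrow> (\<lambda>n. form_coeff d (g n) i) \<longlonglongrightarrow> form_coeff d f i"
proof
  assume "(\<lambda>n. norm_coeff d (g n) i) \<longlonglongrightarrow> norm_coeff d f i"
  from tendsto_mult[OF tendsto_const this, of "of_nat (d choose i)"]
  show "(\<lambda>n. form_coeff d (g n) i) \<longlonglongrightarrow> form_coeff d f i"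
    using assms by (simp add: norm_coeff_def)
qed (use assms in \<open>auto simp: norm_coeff_def intro!: tendsto_divide\<close>)

text \<open>The product topology on sequences is metrizable, so closure points are limits of
  sequences, coordinate by coordinate. Coordinates above d vanish on forms, and the binomial weights
  of the others are nonzero.\<close>

lemma form_topology_closure_of_iff:
  assumes "S \<subseteq> binary_forms d"
  shows "f \<in> form_topology d closure_of S \<longleftrightarrow> f \<in> binary_forms d \<and>
    (\<exists>g. (\<forall>n. g n \<in> S) \<and> (\<forall>i\<le>d. (\<lambda>n. norm_coeff d (g n) i) \<longlonglongrightarrow> norm_coeff d f i))"
proof (cases "f \<in> binary_forms d")
  case True
  have high: "form_coeff d g i = 0" if "i > d" "g \<in> binary_forms d" for g i
    using that by (auto simp: form_coeff_def binary_forms_def)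
  have "f \<in> form_topology d closure_of S \<longleftrightarrow> form_coeff d f \<in> closure (form_coeff d ` S)"
  proof
    assume L: "f \<in> form_topology d closure_of S"
    show "form_coeff d f \<in> closure (form_coeff d ` S)"
      unfolding closure_iff_nhds_not_empty
    proof (intro allI impI)
      fix A V assume A: "V \<subseteq> A" "open V" "form_coeff d f \<in> V"
      have meets: "\<exists>y. y \<in> S \<and> y \<in> T" if "f \<in> T" "openin (form_topology d) T" for T
        using L that by (simp add: in_closure_of)
      have "openin (form_topology d) (form_coeff d -` V \<inter> binary_forms d)"
        unfolding form_topology_def openin_pullback_topology using A(2) by auto
      then obtain g where "g \<in> S" "g \<in> form_coeff d -` V \<inter> binary_forms d"
        using meets[of "form_coeff d -` V \<inter> binary_forms d"] A(3) True by auto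
      then show "form_coeff d ` S \<inter> A \<noteq> {}" using A(1) by auto
    qed
  next
    assume R: "form_coeff d f \<in> closure (form_coeff d ` S)"
    show "f \<in> form_topology d closure_of S"
      unfolding in_closure_of
    proof (intro conjI allI impI)
      show "f \<in> topspace (form_topology d)"
        using True by (simp add: form_topology_def topspace_pullback_topology)
      fix T assume T: "f \<in> T \<and> openin (form_topology d) T"
      then obtain V where V: "open V" "T = form_coeff d -` V \<inter> binary_forms d"
        unfolding form_topology_def openin_pullback_topology by auto
      have "V \<inter> form_coeff d ` S \<noteq> {}"
        using open_Int_closure_eq_empty[OF V(1), of "form_coeff d ` S"] R T V(2) by auto
      then obtain g where "g \<in> S" "form_coeff d g \<in> V" by auto
      then show "\<exists>y. y \<in> S \<and> y \<in> T" using V assms by auto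
    qed
  qed
  also have "\<dots> \<longleftrightarrow> (\<exists>x. (\<forall>n. x n \<in> form_coeff d ` S) \<and> x \<longlonglongrightarrow> form_coeff d f)"
    by (rule closure_sequential)
  also have "\<dots> \<longleftrightarrow> (\<exists>g. (\<forall>n. g n \<in> S) \<and> (\<lambda>n. form_coeff d (g n)) \<longlonglongrightarrow> form_coeff d f)"
  proof
    assume "\<exists>x. (\<forall>n. x n \<in> form_coeff d ` S) \<and> x \<longlonglongrightarrow> form_coeff d f"
    then obtain x where x: "\<forall>n. x n \<in> form_coeff d ` S" "x \<longlonglongrightarrow> form_coeff d f" by blast
    then have "\<forall>n. \<exists>h. h \<in> S \<and> x n = form_coeff d h" by blast
    then obtain g where "\<And>n. g n \<in> S" "\<And>n. x n = form_coeff d (g n)" by metis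
    moreover from this have "x = (\<lambda>n. form_coeff d (g n))" by auto
    ultimately show "\<exists>g. (\<forall>n. g n \<in> S) \<and> (\<lambda>n. form_coeff d (g n)) \<longlonglongrightarrow> form_coeff d f"
      using x(2) by (intro exI[of _ g]) simp
  next
    assume "\<exists>g. (\<forall>n. g n \<in> S) \<and> (\<lambda>n. form_coeff d (g n)) \<longlonglongrightarrow> form_coeff d f"
    then obtain g where "\<forall>n. g n \<in> S" "(\<lambda>n. form_coeff d (g n)) \<longlonglongrightarrow> form_coeff d f" by blast
    then show "\<exists>x. (\<forall>n. x n \<in> form_coeff d ` S) \<and> x \<longlonglongrightarrow> form_coeff d f"
      by (intro exI[of _ "\<lambda>n. form_coeff d (g n)"]) simp
  qed
  also have "\<dots> \<longleftrightarrow> (\<exists>g. (\<forall>n. g n \<in> S) \<and> (\<forall>i\<le>d. (\<lambda>n. norm_coeff d (g n) i) \<longlonglongrightarrow> norm_coeff d f i))"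
  proof (rule iff_exI, rule conj_cong[OF refl])
    fix g :: "nat \<Rightarrow> complex poly poly"
    assume g: "\<forall>n. g n \<in> S"
    have "(\<lambda>n. form_coeff d (g n) i) \<longlonglongrightarrow> form_coeff d f i" if "i > d" for i
    proof -
      have "form_coeff d (g n) i = 0" for n using g assms that by (intro high) auto
      then show ?thesis using high[OF that True] by simp
    qed
    then have "(\<forall>i. (\<lambda>n. form_coeff d (g n) i) \<longlonglongrightarrow> form_coeff d f i)
        \<longleftrightarrow> (\<forall>i\<le>d. (\<lambda>n. form_coeff d (g n) i) \<longlonglongrightarrow> form_coeff d f i)"
      by (meson not_le)
    then show "(\<lambda>n. form_coeff d (g n)) \<longlonglongrightarrow> form_coeff d f
        \<longleftrightarrow> (\<forall>i\<le>d. (\<lambda>n. norm_coeff d (g n) i) \<longlonglongrightarrow> norm_coeff d f i)"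
      unfolding tendsto_sequence_iff by (simp add: tendsto_norm_coeff_iff)
  qed
  finally show ?thesis using True by simp
next
  case False
  then show ?thesis by (auto simp: in_closure_of form_topology_def topspace_pullback_topology)
qed

section \<open>Border rank as the least degree of an annihilator\<close>

text \<open>The rank is exactly r here. The closures of the strata are not nested, since strata of
  large rank are empty, so a bound on the rank of approximants does not yet give one
  stratum.\<close>

definition rank_stratum :: "nat \<Rightarrow> nat \<Rightarrow> complex poly poly set" where
  "rank_stratum d r = {g \<in> binary_forms d. g \<noteq> 0 \<and> waring_rank d g = r}"

lemma closure_of_rank_stratum_imp_has_apolar:
  assumes "d > 0" "f \<in> form_topology d closure_of rank_stratum d r"
  shows "has_apolar d r (norm_coeff d f)"
proof -
  have "rank_stratum d r \<subseteq> binary_forms d" by (auto simp: rank_stratum_def)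
  then obtain g where g: "\<And>n. g n \<in> rank_stratum d r"
    and lim: "\<And>i. i \<le> d \<Longrightarrow> (\<lambda>n. norm_coeff d (g n) i) \<longlonglongrightarrow> norm_coeff d f i"
    using assms(2) form_topology_closure_of_iff by blast
  have "has_apolar d r (norm_coeff d (g n))" for n
    using power_sum_waring_rank[OF assms(1), of "g n"] power_sum_imp_has_apolar g[of n]
    by (auto simp: rank_stratum_def)
  then show ?thesis by (rule has_apolar_closed[where x = "\<lambda>n. norm_coeff d (g n)"]) (rule lim)
qed

text \<open>The approximants have rank at most r, possibly varying along the sequence. The closure
  of a finite union is the union of the closures, which singles out one rank.\<close>

lemma has_apolar_imp_closure_of_rank_stratum:
  assumes "d > 0" "f \<in> binary_forms d" "f \<noteq> 0" "has_apolar d r (norm_coeff d f)"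
  obtains r' where "r' \<le> r" "f \<in> form_topology d closure_of rank_stratum d r'"
proof -
  obtain x where x: "\<And>n. power_sum d r (x n)" "\<And>i. i \<le> d \<Longrightarrow> (\<lambda>n. x n i) \<longlonglongrightarrow> norm_coeff d f i"
    using has_apolar_imp_power_sum_limit[OF assms(4)] by (auto simp: power_sum_limit_def)
  have "form d (norm_coeff d f) \<noteq> 0" using assms(2,3) by (simp add: form_norm_coeff)
  then obtain i where i: "i \<le> d" "norm_coeff d f i \<noteq> 0" by (auto simp: form_eq_0_iff)
  \<comment> \<open>On this tail an entry stays nonzero: the zero form lies in no stratum.\<close>
  obtain N where N: "\<And>n. n \<ge> N \<Longrightarrow> x n i \<noteq> 0"
    using tendsto_imp_eventually_ne[OF x(2)[OF i(1)] i(2)] by (auto simp: eventually_sequentially)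
  define g where "g n = form d (x (n + N))" for n
  have lim: "(\<lambda>n. norm_coeff d (g n) i) \<longlonglongrightarrow> norm_coeff d f i" if "i \<le> d" for i
    unfolding g_def norm_coeff_form[OF that] using x(2)[OF that] by (rule LIMSEQ_ignore_initial_segment)
  have "g n \<in> \<Union> (rank_stratum d ` {..r})" for n
  proof -
    have "form d (norm_coeff d (g n)) = form d (x (n + N))" unfolding g_def by (simp add: form_norm_coeff)
    then have "norm_coeff d (g n) i = x (n + N) i" if "i \<le> d" for i using that by (simp add: form_eq_iff)
    then have "power_sum d r (norm_coeff d (g n))"
      using x(1)[of "n + N"] unfolding power_sum_def power_rep_def by simp
    moreover have "g n \<noteq> 0" using N[of "n + N"] i(1) by (auto simp: g_def form_eq_0_iff)
    ultimately show ?thesis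
      using waring_rank_le[OF _ assms(1)] by (auto simp: rank_stratum_def g_def)
  qed
  moreover have sub: "\<Union> (rank_stratum d ` {..r}) \<subseteq> binary_forms d" by (auto simp: rank_stratum_def)
  ultimately have "f \<in> form_topology d closure_of \<Union> (rank_stratum d ` {..r})"
    unfolding form_topology_closure_of_iff[OF sub] using assms(2) lim
    by (intro conjI exI[of _ g]) auto
  also have "form_topology d closure_of \<Union> (rank_stratum d ` {..r})
      = (\<Union>r'\<le>r. form_topology d closure_of rank_stratum d r')"
    by (subst closure_of_Union) auto
  finally show ?thesis using that by auto
qed

text \<open>An annihilator of degree r places \<open>f\<close> in the closure of some stratum of
  rank r' at most r. If r' were smaller, there would be an annihilator of degree r - 1; so r' =
  r.\<close>

lemma border_rank_eqI:
  assumes "d > 0" "f \<in> binary_forms d" "f \<noteq> 0"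
    and "has_apolar d r (norm_coeff d f)" "\<not> has_apolar d (r - 1) (norm_coeff d f)"
  shows "border_rank d f = r"
  unfolding border_rank_def rank_stratum_def[symmetric]
proof (rule Least_equality)
  have lower: "r \<le> r'" if "f \<in> form_topology d closure_of rank_stratum d r'" for r'
  proof (rule ccontr)
    assume "\<not> r \<le> r'"
    then have "r' \<le> r - 1" by simp
    then show False
      using has_apolar_mono[OF closure_of_rank_stratum_imp_has_apolar[OF assms(1) that]] assms(5) by simp
  qed
  obtain r' where "r' \<le> r" "f \<in> form_topology d closure_of rank_stratum d r'"
    by (rule has_apolar_imp_closure_of_rank_stratum[OF assms(1-4)])
  then show "f \<in> form_topology d closure_of rank_stratum d r" using lower[of r'] by auto
  show "r \<le> r'" if "f \<in> form_topology d closure_of rank_stratum d r'" for r' by (rule lower[OF that])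
qed

lemma has_apolar_border_rank:
  assumes "d > 0" "f \<in> binary_forms d" "f \<noteq> 0"
  shows "has_apolar d (border_rank d f) (norm_coeff d f)"
proof (rule closure_of_rank_stratum_imp_has_apolar[OF assms(1)])
  obtain r where "power_sum d r (norm_coeff d f)" using power_sum_exists by blast
  then have "has_apolar d r (norm_coeff d f)" by (rule power_sum_imp_has_apolar)
  then obtain r' where "f \<in> form_topology d closure_of rank_stratum d r'"
    by (rule has_apolar_imp_closure_of_rank_stratum[OF assms])
  then have "\<exists>r. f \<in> form_topology d closure_of rank_stratum d r" ..
  then show "f \<in> form_topology d closure_of rank_stratum d (border_rank d f)"
    unfolding border_rank_def rank_stratum_def by (rule LeastI_ex)
qed

section \<open>Sylvester matrices under linear substitutions\<close>

text \<open>Here \<open>g\<close> is the dehomogenization of a form of formal degree n, which must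
  be supplied because the coefficient of x^n may vanish.\<close>

definition hom_subst :: "nat \<Rightarrow> 'a::comm_ring_1 poly \<Rightarrow> 'a poly \<Rightarrow> 'a poly \<Rightarrow> 'a poly" where
  "hom_subst n L M g = (\<Sum>k\<le>n. smult (coeff g k) (L ^ k * M ^ (n - k)))"

text \<open>
  The substitution \<open>x \<mapsto> L\<close>, \<open>y \<mapsto> M\<close> on dehomogenized forms of degree \<open>n - 1\<close>; rows and
  columns are indexed like those of the Sylvester matrix, by descending powers of \<open>x\<close>.
\<close>

definition subst_mat :: "nat \<Rightarrow> 'a::comm_ring_1 poly \<Rightarrow> 'a poly \<Rightarrow> 'a mat" where
  "subst_mat n L M = mat n n (\<lambda>(i, j). coeff (L ^ (n - 1 - i) * M ^ i) (n - 1 - j))"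

lemma hom_subst_add: "hom_subst n L M (g + h) = hom_subst n L M g + hom_subst n L M h"
  by (simp add: hom_subst_def smult_add_left sum.distrib)

lemma hom_subst_smult: "hom_subst n L M (smult c g) = smult c (hom_subst n L M g)"
  by (simp add: hom_subst_def smult_sum2)

lemma hom_subst_0 [simp]: "hom_subst n L M 0 = 0"
  by (simp add: hom_subst_def)

lemma hom_subst_sum: "hom_subst n L M (\<Sum>k\<in>K. g k) = (\<Sum>k\<in>K. hom_subst n L M (g k))"
  by (induction K rule: infinite_finite_induct) (simp_all add: hom_subst_add)

lemma hom_subst_monom_mult:
  assumes "k \<le> a" "degree g \<le> b"
  shows "hom_subst (a + b) L M (monom 1 k * g) = L ^ k * M ^ (a - k) * hom_subst b L M g"
proof -
  have "hom_subst (a + b) L M (monom 1 k * g)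
      = (\<Sum>l\<in>{k..k + b}. smult (coeff (monom 1 k * g) l) (L ^ l * M ^ (a + b - l)))"
    unfolding hom_subst_def
    by (rule sum.mono_neutral_right) (use assms in \<open>auto simp: coeff_monom_mult coeff_eq_0\<close>)
  also have "\<dots> = (\<Sum>l\<le>b. smult (coeff g l) (L ^ (k + l) * M ^ (a + b - (k + l))))"
    by (rule sum.reindex_bij_witness[of _ "\<lambda>l. k + l" "\<lambda>l. l - k"]) (auto simp: coeff_monom_mult)
  also have "\<dots> = (\<Sum>l\<le>b. L ^ k * M ^ (a - k) * smult (coeff g l) (L ^ l * M ^ (b - l)))"
  proof (rule sum.cong)
    fix l assume "l \<in> {..b}"
    then have "a + b - (k + l) = (a - k) + (b - l)" using assms by auto
    then show "smult (coeff g l) (L ^ (k + l) * M ^ (a + b - (k + l)))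
      = L ^ k * M ^ (a - k) * smult (coeff g l) (L ^ l * M ^ (b - l))"
      by (simp add: power_add mult_ac)
  qed simp
  finally show ?thesis by (simp add: hom_subst_def sum_distrib_left)
qed

lemma hom_subst_monom: "k \<le> a \<Longrightarrow> hom_subst a L M (monom 1 k) = L ^ k * M ^ (a - k)"
  using hom_subst_monom_mult[of k a 1 0 L M] by (simp add: hom_subst_def)

lemma hom_subst_mult:
  assumes "degree g \<le> a" "degree h \<le> b"
  shows "hom_subst (a + b) L M (g * h) = hom_subst a L M g * hom_subst b L M h"
proof -
  have g: "g = (\<Sum>k\<le>a. smult (coeff g k) (monom 1 k))"
    using poly_as_sum_of_monoms'[OF assms(1)] by (simp add: smult_monom)
  have "g * h = (\<Sum>k\<le>a. smult (coeff g k) (monom 1 k * h))"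
    by (subst g) (simp add: sum_distrib_right)
  then have "hom_subst (a + b) L M (g * h)
      = (\<Sum>k\<le>a. smult (coeff g k) (hom_subst a L M (monom 1 k)) * hom_subst b L M h)"
    using assms(2) by (simp add: hom_subst_sum hom_subst_smult hom_subst_monom_mult hom_subst_monom)
  also have "\<dots> = hom_subst a L M (\<Sum>k\<le>a. smult (coeff g k) (monom 1 k)) * hom_subst b L M h"
    by (simp add: hom_subst_sum hom_subst_smult sum_distrib_right)
  finally show ?thesis using g by simp
qed

lemma degree_linear_power_le:
  fixes L :: "'a::comm_ring_1 poly"
  assumes "degree L \<le> 1"
  shows "degree (L ^ k) \<le> k"
  using degree_power_le[of L k] assms by (metis dual_order.trans mult.commute mult_le_mono2 nat_mult_1_right)

lemma hom_subst_linear_power: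
  assumes "degree P \<le> 1"
  shows "hom_subst k L M (P ^ k) = hom_subst 1 L M P ^ k"
proof (induction k)
  case (Suc k)
  then show ?case
    using hom_subst_mult[OF assms degree_linear_power_le[OF assms, of k], of L M] by simp
qed (simp add: hom_subst_def)

lemma hom_subst_linear: "hom_subst 1 L M [:q, p:] = smult p L + smult q M"
  by (simp add: hom_subst_def)

text \<open>The rows of \<open>subst_mat\<close> are the images of the monomials, so it acts on
  coefficient vectors from the right.\<close>

lemma subst_mat_mult_entry:
  assumes "i < n" "j < n" "degree R \<le> n - 1"
  shows "(\<Sum>k<n. coeff R (n - 1 - k) * subst_mat n L M $$ (k, j))
    = coeff (hom_subst (n - 1) L M R) (n - 1 - j)"
proof -
  have "coeff (hom_subst (n - 1) L M R) (n - 1 - j)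
      = (\<Sum>k\<le>n - 1. coeff R k * coeff (L ^ k * M ^ (n - 1 - k)) (n - 1 - j))"
    by (simp add: hom_subst_def coeff_sum)
  also have "\<dots> = (\<Sum>k<n. coeff R (n - 1 - k) * coeff (L ^ (n - 1 - k) * M ^ k) (n - 1 - j))"
    by (rule sum.reindex_bij_witness[of _ "\<lambda>k. n - 1 - k" "\<lambda>k. n - 1 - k"]) (use assms in auto)
  finally show ?thesis using assms by (simp add: subst_mat_def)
qed

lemma subst_mat_mult:
  assumes "degree P \<le> 1" "degree Q \<le> 1"
  shows "subst_mat n P Q * subst_mat n L M = subst_mat n (hom_subst 1 L M P) (hom_subst 1 L M Q)"
proof (rule eq_matI)
  fix i j
  assume "i < dim_row (subst_mat n (hom_subst 1 L M P) (hom_subst 1 L M Q))"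
    "j < dim_col (subst_mat n (hom_subst 1 L M P) (hom_subst 1 L M Q))"
  then have ij: "i < n" "j < n" by (simp_all add: subst_mat_def)
  let ?R = "P ^ (n - 1 - i) * Q ^ i"
  have d: "degree (P ^ (n - 1 - i)) \<le> n - 1 - i" "degree (Q ^ i) \<le> i"
    using degree_linear_power_le assms by auto
  have s: "n - 1 - i + i = n - 1" using ij by simp
  have deg: "degree ?R \<le> n - 1"
    using degree_mult_le[of "P ^ (n - 1 - i)" "Q ^ i"] d s by linarith
  have "(subst_mat n P Q * subst_mat n L M) $$ (i, j)
      = (\<Sum>k<n. coeff ?R (n - 1 - k) * subst_mat n L M $$ (k, j))"
    using ij by (simp add: subst_mat_def scalar_prod_def lessThan_atLeast0)
  also have "\<dots> = coeff (hom_subst (n - 1) L M ?R) (n - 1 - j)"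
    by (rule subst_mat_mult_entry[OF ij deg])
  also have "hom_subst (n - 1) L M ?R = hom_subst 1 L M P ^ (n - 1 - i) * hom_subst 1 L M Q ^ i"
    using hom_subst_mult[OF d, of L M] s assms by (simp only: hom_subst_linear_power)
  finally show "(subst_mat n P Q * subst_mat n L M) $$ (i, j)
      = subst_mat n (hom_subst 1 L M P) (hom_subst 1 L M Q) $$ (i, j)"
    using ij by (simp add: subst_mat_def)
qed (simp_all add: subst_mat_def)

text \<open>Reading the rows as monomial multiples of \<open>g\<close> and \<open>h\<close> in
  formal degree m + n - 1 makes the Sylvester matrix amenable to substitutions.\<close>

lemma sylvester_row:
  fixes g h :: "'a::comm_ring_1 poly"
  assumes "degree g \<le> m" "degree h \<le> n" "i < m + n" "j < m + n"
  shows "sylvester_mat_sub m n g h $$ (i, j)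
    = coeff (if i < n then monom 1 (n - 1 - i) * g else monom 1 (m + n - 1 - i) * h) (m + n - 1 - j)"
proof (cases "i < n")
  case True
  show ?thesis
  proof (cases "i \<le> j \<and> j - i \<le> m")
    case t: True
    then have "n - 1 - i \<le> m + n - 1 - j" "m + n - 1 - j - (n - 1 - i) = m + i - j" using True assms by auto
    then show ?thesis using True t assms by (simp add: sylvester_mat_sub_index coeff_monom_mult)
  next
    case f: False
    show ?thesis
    proof (cases "i \<le> j")
      case t: True
      then have "\<not> n - 1 - i \<le> m + n - 1 - j" using f True assms by auto
      then show ?thesis using True f assms by (simp add: sylvester_mat_sub_index coeff_monom_mult)
    next
      case False
      then have "degree g < m + n - 1 - j - (n - 1 - i)" using True assms by auto
      then have "coeff g (m + n - 1 - j - (n - 1 - i)) = 0" by (rule coeff_eq_0)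
      then show ?thesis using True f assms by (simp add: sylvester_mat_sub_index coeff_monom_mult)
    qed
  qed
next
  case False
  show ?thesis
  proof (cases "i - n \<le> j \<and> j \<le> i")
    case t: True
    then have "m + n - 1 - i \<le> m + n - 1 - j" "m + n - 1 - j - (m + n - 1 - i) = i - j" using False assms by auto
    then show ?thesis using False t assms by (simp add: sylvester_mat_sub_index coeff_monom_mult)
  next
    case f: False
    show ?thesis
    proof (cases "j \<le> i")
      case t: True
      then have "degree h < m + n - 1 - j - (m + n - 1 - i)" using f False assms by auto
      then have "coeff h (m + n - 1 - j - (m + n - 1 - i)) = 0" by (rule coeff_eq_0)
      then show ?thesis using False f assms by (simp add: sylvester_mat_sub_index coeff_monom_mult)
    next
      case t: False
      then have "\<not> m + n - 1 - i \<le> m + n - 1 - j" using assms by auto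
      then show ?thesis using False f assms by (simp add: sylvester_mat_sub_index coeff_monom_mult)
    qed
  qed
qed

lemma degree_hom_subst_le:
  fixes L M :: "'a::comm_ring_1 poly"
  assumes "degree L \<le> 1" "degree M \<le> 1"
  shows "degree (hom_subst n L M g) \<le> n"
  unfolding hom_subst_def
proof (rule degree_sum_le)
  fix k assume "k \<in> {..n}"
  then have k: "k \<le> n" by simp
  have "degree (smult (coeff g k) (L ^ k * M ^ (n - k))) \<le> degree (L ^ k) + degree (M ^ (n - k))"
    by (rule order.trans[OF degree_smult_le degree_mult_le])
  also have "\<dots> \<le> k + (n - k)"
    by (intro add_mono degree_linear_power_le assms)
  finally show "degree (smult (coeff g k) (L ^ k * M ^ (n - k))) \<le> n" using k by simp
qed simp

lemma coeff_mult_as_sum: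
  fixes R g :: "'a::comm_ring_1 poly"
  assumes "degree R < n"
  shows "(\<Sum>k<n. coeff R (n - 1 - k) * coeff (monom 1 (n - 1 - k) * g) l) = coeff (R * g) l"
proof -
  have "R = (\<Sum>k\<le>n - 1. smult (coeff R k) (monom 1 k))"
    using poly_as_sum_of_monoms'[of R "n - 1"] assms by (simp add: smult_monom)
  also have "\<dots> = (\<Sum>k<n. smult (coeff R (n - 1 - k)) (monom 1 (n - 1 - k)))"
    by (rule sum.reindex_bij_witness[of _ "\<lambda>k. n - 1 - k" "\<lambda>k. n - 1 - k"]) (use assms in auto)
  finally have R: "R = (\<Sum>k<n. smult (coeff R (n - 1 - k)) (monom 1 (n - 1 - k)))" .
  have "R * g = (\<Sum>k<n. smult (coeff R (n - 1 - k)) (monom 1 (n - 1 - k) * g))"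
    by (subst R) (simp add: sum_distrib_right)
  then show ?thesis by (simp add: coeff_sum)
qed

text \<open>
  Comparing determinants gives the behaviour of the resultant under linear substitutions.
\<close>

lemma sylvester_subst:
  fixes L M :: "'a::comm_ring_1 poly"
  assumes "degree g \<le> m" "degree h \<le> n" and LM: "degree L \<le> 1" "degree M \<le> 1"
  shows "sylvester_mat_sub m n g h * subst_mat (m + n) L M
    = four_block_mat (subst_mat n L M) (0\<^sub>m n m) (0\<^sub>m m n) (subst_mat m L M)
      * sylvester_mat_sub m n (hom_subst m L M g) (hom_subst n L M h)"
    (is "_ = ?B * ?S")
proof (rule eq_matI)
  let ?N = "m + n"
  let ?g = "hom_subst m L M g" and ?h = "hom_subst n L M h"
  have dims: "dim_row ?B = ?N" "dim_col ?B = ?N" "dim_row ?S = ?N" "dim_col ?S = ?N"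
    by (simp_all add: subst_mat_def)
  fix i j
  assume "i < dim_row (?B * ?S)" "j < dim_col (?B * ?S)"
  then have ij: "i < ?N" "j < ?N" using dims by simp_all
  have degs: "degree ?g \<le> m" "degree ?h \<le> n" using degree_hom_subst_le[OF LM] by auto
  define R where "R = (if i < n then monom 1 (n - 1 - i) * g else monom 1 (?N - 1 - i) * h)"
  have "degree R \<le> ?N - 1"
  proof (cases "i < n")
    case True
    have "degree R \<le> (n - 1 - i) + degree g"
      unfolding R_def using True degree_mult_le[of "monom 1 (n - 1 - i)" g] degree_monom_le[of "1::'a" "n - 1 - i"] by simp
    then show ?thesis using assms True by linarith
  next
    case False
    have "degree R \<le> (?N - 1 - i) + degree h"
      unfolding R_def using False degree_mult_le[of "monom 1 (?N - 1 - i)" h] degree_monom_le[of "1::'a" "?N - 1 - i"] by simp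
    then show ?thesis using assms False ij by linarith
  qed
  then have "(\<Sum>k<?N. coeff R (?N - 1 - k) * subst_mat ?N L M $$ (k, j)) = coeff (hom_subst (?N - 1) L M R) (?N - 1 - j)"
    by (rule subst_mat_mult_entry[OF ij])
  moreover have "(sylvester_mat_sub m n g h * subst_mat ?N L M) $$ (i, j)
      = (\<Sum>k<?N. coeff R (?N - 1 - k) * subst_mat ?N L M $$ (k, j))"
    using ij assms by (simp add: scalar_prod_def lessThan_atLeast0 sylvester_row R_def subst_mat_def)
  ultimately have lhs: "(sylvester_mat_sub m n g h * subst_mat ?N L M) $$ (i, j) = coeff (hom_subst (?N - 1) L M R) (?N - 1 - j)"
    by simp
  have rhs: "(?B * ?S) $$ (i, j) = (\<Sum>k<?N. ?B $$ (i, k) * ?S $$ (k, j))"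
    using ij dims by (simp add: scalar_prod_def lessThan_atLeast0)
  show "(sylvester_mat_sub m n g h * subst_mat ?N L M) $$ (i, j) = (?B * ?S) $$ (i, j)"
  proof (cases "i < n")
    case True
    \<comment> \<open>The substituted row is \<open>?g\<close> times L^(n-1-i) M^i; expanding that
      factor in monomials writes it through the first n rows of the new Sylvester matrix.\<close>
    have "hom_subst (?N - 1) L M R = L ^ (n - 1 - i) * M ^ i * ?g"
      using hom_subst_monom_mult[of "n - 1 - i" "n - 1" g m L M] True assms by (simp add: R_def add.commute)
    moreover have "(\<Sum>k<?N. ?B $$ (i, k) * ?S $$ (k, j))
        = (\<Sum>k<n. coeff (L ^ (n - 1 - i) * M ^ i) (n - 1 - k) * coeff (monom 1 (n - 1 - k) * ?g) (?N - 1 - j))"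
    proof -
      have "(\<Sum>k<?N. ?B $$ (i, k) * ?S $$ (k, j)) = (\<Sum>k<n. ?B $$ (i, k) * ?S $$ (k, j))"
        by (rule sum.mono_neutral_right) (use True ij in \<open>auto simp: subst_mat_def\<close>)
      also have "\<dots> = (\<Sum>k<n. coeff (L ^ (n - 1 - i) * M ^ i) (n - 1 - k) * coeff (monom 1 (n - 1 - k) * ?g) (?N - 1 - j))"
        by (rule sum.cong) (use True ij degs in \<open>auto simp: subst_mat_def sylvester_row\<close>)
      finally show ?thesis .
    qed
    moreover have "degree (L ^ (n - 1 - i) * M ^ i) < n"
    proof -
      have "degree (L ^ (n - 1 - i) * M ^ i) \<le> (n - 1 - i) + i"
        by (rule order.trans[OF degree_mult_le add_mono]) (intro degree_linear_power_le LM)+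
      then show ?thesis using True by linarith
    qed
    ultimately show ?thesis unfolding lhs rhs by (simp only: coeff_mult_as_sum)
  next
    case False
    define i' where "i' = i - n"
    have i': "i = n + i'" "i' < m" using False ij by (auto simp: i'_def)
    have "hom_subst (?N - 1) L M R = L ^ (m - 1 - i') * M ^ i' * ?h"
      using hom_subst_monom_mult[of "m - 1 - i'" "m - 1" h n L M] i' assms by (simp add: R_def)
    moreover have "(\<Sum>k<?N. ?B $$ (i, k) * ?S $$ (k, j))
        = (\<Sum>k<m. coeff (L ^ (m - 1 - i') * M ^ i') (m - 1 - k) * coeff (monom 1 (m - 1 - k) * ?h) (?N - 1 - j))"
    proof -
      have "(\<Sum>k<?N. ?B $$ (i, k) * ?S $$ (k, j)) = (\<Sum>k\<in>{n..<?N}. ?B $$ (i, k) * ?S $$ (k, j))"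
        by (rule sum.mono_neutral_right) (use i' in \<open>auto simp: subst_mat_def\<close>)
      also have "\<dots> = (\<Sum>k<m. ?B $$ (i, n + k) * ?S $$ (n + k, j))"
        by (rule sum.reindex_bij_witness[of _ "\<lambda>k. n + k" "\<lambda>k. k - n"]) auto
      also have "\<dots> = (\<Sum>k<m. coeff (L ^ (m - 1 - i') * M ^ i') (m - 1 - k) * coeff (monom 1 (m - 1 - k) * ?h) (?N - 1 - j))"
        by (rule sum.cong) (use i' ij degs in \<open>auto simp: subst_mat_def sylvester_row\<close>)
      finally show ?thesis .
    qed
    moreover have "degree (L ^ (m - 1 - i') * M ^ i') < m"
    proof -
      have "degree (L ^ (m - 1 - i') * M ^ i') \<le> (m - 1 - i') + i'"
        by (rule order.trans[OF degree_mult_le add_mono]) (intro degree_linear_power_le LM)+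
      then show ?thesis using i' by linarith
    qed
    ultimately show ?thesis unfolding lhs rhs by (simp only: coeff_mult_as_sum)
  qed
qed (simp_all add: subst_mat_def)

section \<open>Determinants of substitution matrices\<close>

lemma prod_list_diag_mat: "A \<in> carrier_mat n n \<Longrightarrow> prod_list (diag_mat A) = (\<Prod>i<n. A $$ (i, i))"
  unfolding diag_mat_def by (simp add: prod.list_conv_set_nth lessThan_atLeast0)

lemma prod_powers: "(\<Prod>i<n. c ^ i) = c ^ (n * (n - 1) div 2)" for c :: "'a::comm_monoid_mult"
  unfolding power_sum[symmetric] by (simp add: lessThan_atLeast0 Sum_Ico_nat)

text \<open>The substitution is composed of x -> px + qy with y fixed and y -> (r/p) x + ty with x
  fixed. Both matrices are triangular, their diagonals consist of the powers of p and of t with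
  exponents 0 to n - 1, and tp = ps - qr.\<close>

lemma det_subst_mat_nz:
  fixes p q r s :: "'a::field"
  assumes "p \<noteq> 0"
  shows "det (subst_mat n [:q, p:] [:s, r:]) = (p * s - q * r) ^ (n * (n - 1) div 2)"
proof -
  define t where "t = (p * s - q * r) / p"
  let ?U = "subst_mat n [:q, p:] 1" and ?W = "subst_mat n [:0, 1:] [:t, r / p:]"
  have U: "?U \<in> carrier_mat n n" and W: "?W \<in> carrier_mat n n" by (simp_all add: subst_mat_def)
  have coeffU: "coeff ([:q, p:] ^ k) k = p ^ k" for k
  proof (induction k)
    case (Suc k)
    have "degree ([:q, p:] ^ k) \<le> k" by (rule degree_linear_power_le) simp
    then have "coeff ([:q, p:] ^ k) (Suc k) = 0" by (intro coeff_eq_0) simp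
    then show ?case using Suc by simp
  qed simp
  have "det ?U = prod_list (diag_mat ?U)"
  proof (rule det_upper_triangular[OF _ U])
    show "upper_triangular ?U"
    proof (rule upper_triangularI)
      fix i j assume "j < i" "i < dim_row ?U"
      moreover have "degree ([:q, p:] ^ (n - 1 - i)) \<le> n - 1 - i" by (rule degree_linear_power_le) simp
      ultimately show "?U $$ (i, j) = 0" by (auto simp: subst_mat_def intro!: coeff_eq_0)
    qed
  qed
  also have "\<dots> = (\<Prod>i<n. p ^ (n - 1 - i))"
    unfolding prod_list_diag_mat[OF U] by (rule prod.cong) (auto simp: subst_mat_def coeffU)
  also have "\<dots> = (\<Prod>i<n. p ^ i)"
    by (rule prod.reindex_bij_witness[of _ "\<lambda>k. n - 1 - k" "\<lambda>k. n - 1 - k"]) auto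
  finally have detU: "det ?U = p ^ (n * (n - 1) div 2)" by (simp add: prod_powers)
  have X: "[:0, 1:] ^ k * g = monom 1 k * g" for k and g :: "'a poly" by (simp add: monom_altdef)
  have "det ?W = prod_list (diag_mat ?W)"
  proof (rule det_lower_triangular[OF _ W])
    fix i j assume "i < j" "j < n"
    then show "?W $$ (i, j) = 0" unfolding subst_mat_def X by (auto simp: coeff_monom_mult)
  qed
  also have "\<dots> = (\<Prod>i<n. t ^ i)"
    unfolding prod_list_diag_mat[OF W]
    by (rule prod.cong) (auto simp: subst_mat_def X coeff_monom_mult coeff_0_power)
  finally have detW: "det ?W = t ^ (n * (n - 1) div 2)" by (simp add: prod_powers)
  have "?W * ?U = subst_mat n [:q, p:] [:s, r:]"
    using subst_mat_mult[of "[:0, 1:]" "[:t, r / p:]" n "[:q, p:]" 1, unfolded hom_subst_linear] assms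
    by (simp add: t_def field_simps one_pCons)
  then have "det (subst_mat n [:q, p:] [:s, r:]) = det ?W * det ?U"
    using det_mult[OF W U] by simp
  also have "\<dots> = (t * p) ^ (n * (n - 1) div 2)" unfolding detU detW by (simp add: power_mult_distrib)
  finally show ?thesis using assms by (simp add: t_def)
qed

lemma det_subst_mat:
  fixes p q r s :: "'a::field"
  assumes nz: "p * s - q * r \<noteq> 0"
  shows "det (subst_mat n [:q, p:] [:s, r:]) = (p * s - q * r) ^ (n * (n - 1) div 2)"
proof (cases "p = 0")
  case True
  \<comment> \<open>The shear y -> x + y has determinant 1 and replaces the leading coefficient p =
    0 by q, which is nonzero because ps - qr is.\<close>
  have "subst_mat n [:q, p:] [:s, r:] * subst_mat n [:0, 1:] [:1, 1:] = subst_mat n [:q, q:] [:s, r + s:]"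
    using subst_mat_mult[of "[:q, p:]" "[:s, r:]" n "[:0, 1:]" "[:1, 1:]", unfolded hom_subst_linear] True
    by (simp add: add.commute)
  moreover have "det (subst_mat n [:q, p:] [:s, r:] * subst_mat n [:0, 1:] [:1, 1:])
    = det (subst_mat n [:q, p:] [:s, r:]) * det (subst_mat n [:0, 1:] [:1, 1::'a:])"
    by (rule det_mult[of _ n]) (simp_all add: subst_mat_def)
  moreover have "det (subst_mat n [:0, 1:] [:1, 1::'a:]) = 1"
    using det_subst_mat_nz[of 1 n 0 1 1] by simp
  moreover have "det (subst_mat n [:q, q:] [:s, r + s:]) = (p * s - q * r) ^ (n * (n - 1) div 2)"
    using det_subst_mat_nz[of q n q s "r + s"] True nz by (simp add: algebra_simps)
  ultimately show ?thesis by simp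
qed (rule det_subst_mat_nz)

section \<open>The discriminant of a tangential sextic\<close>

lemma sylvester_mat_sub_smult:
  fixes g h :: "'a::comm_ring_1 poly"
  shows "sylvester_mat_sub m n (smult c g) (smult c h) = c \<cdot>\<^sub>m sylvester_mat_sub m n g h"
  by (rule eq_matI) (auto simp: sylvester_mat_sub_index)

text \<open>The partial derivatives in x and y are combinations of those in l and m; this describes
  the effect on Sylvester matrices.\<close>

lemma sylvester_mat_sub_linear_combination:
  fixes g h :: "'a::comm_ring_1 poly"
  shows "sylvester_mat_sub n n (smult p g + smult r h) (smult q g + smult s h)
    = four_block_mat (p \<cdot>\<^sub>m 1\<^sub>m n) (r \<cdot>\<^sub>m 1\<^sub>m n) (q \<cdot>\<^sub>m 1\<^sub>m n) (s \<cdot>\<^sub>m 1\<^sub>m n) * sylvester_mat_sub n n g h"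
    (is "?L = ?B * ?S")
proof (rule eq_matI)
  fix i j
  assume "i < dim_row (?B * ?S)" "j < dim_col (?B * ?S)"
  then have ij: "i < n + n" "j < n + n" by simp_all
  have "(?B * ?S) $$ (i, j) = (\<Sum>k<n + n. ?B $$ (i, k) * ?S $$ (k, j))"
    using ij by (simp add: scalar_prod_def lessThan_atLeast0)
  also have "\<dots> = (\<Sum>k<n. ?B $$ (i, k) * ?S $$ (k, j)) + (\<Sum>k<n. ?B $$ (i, n + k) * ?S $$ (n + k, j))"
  proof -
    have "{..<n + n} = {..<n} \<union> {n..<n + n}" by auto
    moreover have "(\<Sum>k\<in>{n..<n + n}. ?B $$ (i, k) * ?S $$ (k, j)) = (\<Sum>k<n. ?B $$ (i, n + k) * ?S $$ (n + k, j))"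
      by (rule sum.reindex_bij_witness[of _ "\<lambda>k. n + k" "\<lambda>k. k - n"]) auto
    ultimately show ?thesis by (simp add: sum.union_disjoint ivl_disj_int)
  qed
  also have "\<dots> = ?L $$ (i, j)"
  proof (cases "i < n")
    case True
    have "(\<Sum>k<n. ?B $$ (i, k) * ?S $$ (k, j)) = (\<Sum>k<n. if k = i then p * ?S $$ (k, j) else 0)"
      by (rule sum.cong) (use True in auto)
    moreover have "(\<Sum>k<n. ?B $$ (i, n + k) * ?S $$ (n + k, j)) = (\<Sum>k<n. if k = i then r * ?S $$ (n + k, j) else 0)"
      by (rule sum.cong) (use True in auto)
    ultimately show ?thesis using True ij by (auto simp: sylvester_mat_sub_index)
  next
    case False
    define i' where "i' = i - n"
    have i': "i = n + i'" "i' < n" using False ij by (auto simp: i'_def)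
    have "(\<Sum>k<n. ?B $$ (i, k) * ?S $$ (k, j)) = (\<Sum>k<n. if k = i' then q * ?S $$ (k, j) else 0)"
      by (rule sum.cong) (use i' in auto)
    moreover have "(\<Sum>k<n. ?B $$ (i, n + k) * ?S $$ (n + k, j)) = (\<Sum>k<n. if k = i' then s * ?S $$ (n + k, j) else 0)"
      by (rule sum.cong) (use i' in auto)
    ultimately show ?thesis using i' ij by (auto simp: sylvester_mat_sub_index)
  qed
  finally show "?L $$ (i, j) = (?B * ?S) $$ (i, j)" ..
qed simp_all

lemma det_scalar_blocks:
  fixes p q r s :: "'a::idom"
  shows "det (four_block_mat (p \<cdot>\<^sub>m 1\<^sub>m n) (r \<cdot>\<^sub>m 1\<^sub>m n) (q \<cdot>\<^sub>m 1\<^sub>m n) (s \<cdot>\<^sub>m 1\<^sub>m n)) = (p * s - q * r) ^ n"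
proof -
  have "det (four_block_mat (p \<cdot>\<^sub>m 1\<^sub>m n) (r \<cdot>\<^sub>m 1\<^sub>m n) (q \<cdot>\<^sub>m 1\<^sub>m n) (s \<cdot>\<^sub>m 1\<^sub>m n))
      = det ((p \<cdot>\<^sub>m 1\<^sub>m n) * (s \<cdot>\<^sub>m 1\<^sub>m n) - (r \<cdot>\<^sub>m 1\<^sub>m n) * (q \<cdot>\<^sub>m 1\<^sub>m n))"
    by (rule det_four_block_mat) auto
  also have "(p \<cdot>\<^sub>m 1\<^sub>m n) * (s \<cdot>\<^sub>m 1\<^sub>m n) - (r \<cdot>\<^sub>m 1\<^sub>m n) * (q \<cdot>\<^sub>m 1\<^sub>m n) = (p * s - q * r) \<cdot>\<^sub>m 1\<^sub>m n"
    by (rule eq_matI) (auto simp: algebra_simps)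
  finally show ?thesis by simp
qed

text \<open>Only two entries of the first column are nonzero, and both minors are
  triangular.\<close>

lemma det_cyclic_bidiagonal:
  fixes x y z :: "'a::comm_ring_1"
  shows "det (mat 5 5 (\<lambda>(i, j). if i = j then x else if j = Suc i then y else if i = 4 \<and> j = 0 then z else 0))
    = x ^ 5 + z * y ^ 4"
proof -
  let ?M = "mat 5 5 (\<lambda>(i, j). if i = j then x else if j = Suc i then y else if i = 4 \<and> j = 0 then z else 0)"
  let ?U = "mat 4 4 (\<lambda>(i, j). if i = j then x else if j = Suc i then y else 0)"
  let ?L = "mat 4 4 (\<lambda>(i, j). if i = j then y else if i = Suc j then x else 0)"
  have U: "?U \<in> carrier_mat 4 4" and L: "?L \<in> carrier_mat 4 4" by simp_all
  have "det ?M = (\<Sum>i<5. ?M $$ (i, 0) * cofactor ?M i 0)"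
    by (rule laplace_expansion_column) auto
  also have "\<dots> = x * cofactor ?M 0 0 + z * cofactor ?M 4 0"
    by (simp add: eval_nat_numeral)
  also have "cofactor ?M 0 0 = det ?U"
  proof -
    have "mat_delete ?M 0 0 = ?U" by (rule eq_matI) (auto simp: mat_delete_def)
    then show ?thesis by (simp add: cofactor_def)
  qed
  also have "cofactor ?M 4 0 = det ?L"
  proof -
    have "mat_delete ?M 4 0 = ?L" by (rule eq_matI) (auto simp: mat_delete_def)
    then show ?thesis by (simp add: cofactor_def)
  qed
  also have "det ?U = x ^ 4"
    by (subst det_upper_triangular[OF _ U]) (auto simp: prod_list_diag_mat[OF U])
  also have "det ?L = y ^ 4"
    by (subst det_lower_triangular[OF _ L]) (auto simp: prod_list_diag_mat[OF L])
  finally show ?thesis by (simp add: eval_nat_numeral)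
qed

text \<open>The two polynomials are the partial derivatives of a x^6 + 6 b x^5 y + c y^6, divided by
  6, at y = 1. The lower blocks are scalar matrices, so a 5 by 5 determinant with one corner entry
  remains; 3125 is 5 times 5^4, from the corner and the superdiagonal.\<close>

lemma det_sylvester_normal_form:
  fixes a b c :: "'a::idom"
  shows "det (sylvester_mat_sub 5 5 (monom a 5 + monom (5 * b) 4) (monom b 5 + monom c 0))
    = a ^ 5 * c ^ 5 - 3125 * b ^ 6 * c ^ 4"
proof -
  let ?A = "mat 5 5 (\<lambda>(i, j). if i = j then a else if j = Suc i then 5 * b else 0)"
  let ?B = "mat 5 5 (\<lambda>(i, j). if i = 4 \<and> j = 0 then 5 * b else 0)"
  let ?I = "1\<^sub>m 5 :: 'a mat"
  have "sylvester_mat_sub 5 5 (monom a 5 + monom (5 * b) 4) (monom b 5 + monom c 0)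
      = four_block_mat ?A ?B (b \<cdot>\<^sub>m ?I) (c \<cdot>\<^sub>m ?I)"
    (is "sylvester_mat_sub 5 5 ?G ?H = ?R")
  proof (rule eq_matI)
    fix i j
    assume "i < dim_row ?R" "j < dim_col ?R"
    then have ij: "i < 5 + 5" "j < 5 + 5" by simp_all
    have G: "coeff ?G k = (if k = 5 then a else if k = 4 then 5 * b else 0)" for k by simp
    have H: "coeff ?H k = (if k = 5 then b else if k = 0 then c else 0)" for k by simp
    show "sylvester_mat_sub 5 5 ?G ?H $$ (i, j) = ?R $$ (i, j)"
    proof (cases "i < 5")
      case True
      consider "j = i" | "j = Suc i" | "j \<noteq> i" "j \<noteq> Suc i" by blast
      then show ?thesis
      proof cases
        case 3
        have "sylvester_mat_sub 5 5 ?G ?H $$ (i, j) = 0"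
          unfolding sylvester_mat_sub_index[OF ij] G using 3 True by auto
        then show ?thesis using 3 ij True by auto
      qed (use ij True in \<open>simp_all add: sylvester_mat_sub_index\<close>)
    next
      case False
      consider "i = j + 5" | "j = i" | "i \<noteq> j + 5" "j \<noteq> i" by blast
      then show ?thesis
      proof cases
        case 3
        have "sylvester_mat_sub 5 5 ?G ?H $$ (i, j) = 0"
          unfolding sylvester_mat_sub_index[OF ij] H using 3 False by auto
        then show ?thesis using 3 ij False by auto
      qed (use ij False in \<open>simp_all add: sylvester_mat_sub_index\<close>)
    qed
  qed simp_all
  also have "det \<dots> = det (?A * (c \<cdot>\<^sub>m ?I) - ?B * (b \<cdot>\<^sub>m ?I))"
    by (rule det_four_block_mat) auto
  also have "?A * (c \<cdot>\<^sub>m ?I) - ?B * (b \<cdot>\<^sub>m ?I)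
      = mat 5 5 (\<lambda>(i, j). if i = j then a * c else if j = Suc i then 5 * b * c
          else if i = 4 \<and> j = 0 then - (5 * b * b) else 0)"
  proof -
    have scale: "X * (k \<cdot>\<^sub>m ?I) = k \<cdot>\<^sub>m X" if "X \<in> carrier_mat 5 5" for X and k :: 'a
      using mult_smult_distrib[OF that one_carrier_mat, of k] right_mult_one_mat[OF that] by simp
    have "?A * (c \<cdot>\<^sub>m ?I) = c \<cdot>\<^sub>m ?A" "?B * (b \<cdot>\<^sub>m ?I) = b \<cdot>\<^sub>m ?B" by (rule scale, simp)+
    then show ?thesis by (intro eq_matI) auto
  qed
  also have "det \<dots> = (a * c) ^ 5 + - (5 * b * b) * (5 * b * c) ^ 4"
    by (rule det_cyclic_bidiagonal)
  finally show ?thesis by (simp add: power_mult_distrib eval_nat_numeral algebra_simps)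
qed

section \<open>Derivatives of a tangential sextic\<close>

lemma dir_deriv_add: "dir_deriv u v (f + g) = dir_deriv u v f + dir_deriv u v g"
proof -
  have "map_poly pderiv (f + g) = map_poly pderiv f + map_poly pderiv g"
    by (intro poly_eqI) (simp add: coeff_map_poly pderiv_add)
  then show ?thesis by (simp add: dir_deriv_def pderiv_add smult_add_right)
qed

lemma dir_deriv_const: "dir_deriv u v [:[:c:]:] = 0"
proof -
  have "map_poly pderiv [:[:c:]:] = 0"
    by (intro poly_eqI) (simp add: coeff_map_poly coeff_pCons pderiv_pCons split: nat.split)
  then show ?thesis by (simp add: dir_deriv_def pderiv_pCons)
qed

lemma dir_deriv_linear: "dir_deriv u v (linear_form p q) = [:[:u * p + v * q:]:]"
proof -
  have "map_poly pderiv (linear_form p q) = [:[:p:]:]"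
    unfolding linear_form_def
    by (intro poly_eqI) (simp add: coeff_map_poly coeff_pCons pderiv_pCons split: nat.split)
  then show ?thesis by (simp add: dir_deriv_def linear_form_def pderiv_pCons)
qed

lemma dir_deriv_power: "dir_deriv u v (g ^ Suc n) = of_nat (Suc n) * g ^ n * dir_deriv u v g"
proof (induction n)
  case (Suc n)
  have "dir_deriv u v (g ^ Suc (Suc n)) = dir_deriv u v g * g ^ Suc n + g * dir_deriv u v (g ^ Suc n)"
    by (simp only: power_Suc[of g "Suc n"] dir_deriv_mult)
  also have "\<dots> = of_nat (Suc (Suc n)) * g ^ Suc n * dir_deriv u v g"
    unfolding Suc by (simp add: algebra_simps)
  finally show ?case .
qed simp

text \<open>
  The sextics annihilated by a cubic with a double root; the case \<open>b = 0\<close> is that of border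
  rank at most \<open>2\<close> without a root of multiplicity \<open>5\<close>.
\<close>

definition tangent_form :: "complex \<Rightarrow> complex \<Rightarrow> complex \<Rightarrow> complex poly poly \<Rightarrow> complex poly poly \<Rightarrow> complex poly poly" where
  "tangent_form a b c l m = [:[:a:]:] * l ^ 6 + [:[:6 * b:]:] * (l ^ 5 * m) + [:[:c:]:] * m ^ 6"

text \<open>The chain rule, with x and y the derivatives of L and M: the two brackets on the right
  are the partial derivatives in L and M, up to the factor 6.\<close>

lemma tangent_identity:
  fixes a b c x y L M :: "'a::comm_ring_1"
  shows "a * (6 * L ^ 5 * x) + 6 * b * (5 * L ^ 4 * x * M + L ^ 5 * y) + c * (6 * M ^ 5 * y)
    = 6 * (x * (a * L ^ 5 + 5 * b * (L ^ 4 * M)) + y * (b * L ^ 5 + c * M ^ 5))"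
  by (simp add: algebra_simps)

text \<open>The directions (1, 0) and (0, 1) give the two quintics of the discriminant; on a
  determinant of order 10 the factor 6 cancels the normalization 6^10 of \<open>I10\<close>.\<close>

lemma poly_dir_deriv_tangent_form:
  "poly (dir_deriv u v (tangent_form a b c (linear_form p q) (linear_form r s))) 1
    = smult 6 (hom_subst 5 [:q, p:] [:s, r:]
        (smult (u * p + v * q) (monom a 5 + monom (5 * b) 4) + smult (u * r + v * s) (monom b 5 + monom c 0)))"
proof -
  let ?l = "linear_form p q" and ?m = "linear_form r s"
  define x where "x = u * p + v * q"
  define y where "y = u * r + v * s"
  have 6: "dir_deriv u v (g ^ 6) = 6 * g ^ 5 * dir_deriv u v g" for g
    using dir_deriv_power[of u v g 5] by (simp add: eval_nat_numeral)
  have 5: "dir_deriv u v (g ^ 5) = 5 * g ^ 4 * dir_deriv u v g" for g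
    using dir_deriv_power[of u v g 4] by (simp add: eval_nat_numeral)
  have "dir_deriv u v (tangent_form a b c ?l ?m) =
     [:[:a:]:] * (6 * ?l ^ 5 * [:[:x:]:])
     + [:[:6 * b:]:] * (5 * ?l ^ 4 * [:[:x:]:] * ?m + ?l ^ 5 * [:[:y:]:])
     + [:[:c:]:] * (6 * ?m ^ 5 * [:[:y:]:])"
    unfolding tangent_form_def dir_deriv_add dir_deriv_mult dir_deriv_const 6 5 dir_deriv_linear x_def y_def
    by simp
  moreover have "poly ?l 1 = [:q, p:]" "poly ?m 1 = [:s, r:]" by (simp_all add: linear_form_def)
  ultimately have "poly (dir_deriv u v (tangent_form a b c ?l ?m)) 1 =
     [:a:] * (6 * [:q, p:] ^ 5 * [:x:])
     + [:6 * b:] * (5 * [:q, p:] ^ 4 * [:x:] * [:s, r:] + [:q, p:] ^ 5 * [:y:])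
     + [:c:] * (6 * [:s, r:] ^ 5 * [:y:])"
    by (simp only: poly_add poly_mult poly_power poly_pCons poly_0 mult_zero_right add_0_right poly_numeral)
  moreover define L M where "L = [:q, p:]" and "M = [:s, r:]"
  ultimately have lhs: "poly (dir_deriv u v (tangent_form a b c ?l ?m)) 1 =
     [:a:] * (6 * L ^ 5 * [:x:]) + [:6 * b:] * (5 * L ^ 4 * [:x:] * M + L ^ 5 * [:y:])
     + [:c:] * (6 * M ^ 5 * [:y:])"
    by simp
  have monom: "monom z k = smult z (monom 1 k)" for z :: complex and k by (simp add: smult_monom)
  have hm: "hom_subst 5 L M (monom 1 5) = L ^ 5" "hom_subst 5 L M (monom 1 4) = L ^ 4 * M"
    "hom_subst 5 L M (monom 1 0) = M ^ 5"
    by (subst hom_subst_monom; simp)+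
  have hs: "hom_subst 5 L M (smult x (monom a 5 + monom (5 * b) 4) + smult y (monom b 5 + monom c 0))
     = smult x (smult a (L ^ 5) + smult (5 * b) (L ^ 4 * M)) + smult y (smult b (L ^ 5) + smult c (M ^ 5))"
    unfolding monom[of a] monom[of "5 * b"] monom[of b] monom[of c] hom_subst_add hom_subst_smult
    unfolding hm ..
  have smult: "smult z P = [:z:] * P" for z and P :: "complex poly" by simp
  have num: "[:6 * z:] = 6 * [:z:]" "[:5 * z:] = 5 * [:z:]" "[:6:] = (6 :: complex poly)" for z :: complex
    by (simp_all add: numeral_poly)
  show ?thesis
    unfolding x_def[symmetric] y_def[symmetric] L_def[symmetric] M_def[symmetric] lhs hs
    unfolding smult num
    by (rule tangent_identity)
qed

text \<open>The exponent is 30 = 45 - 20 + 5: substitution has determinant exponent 45 on forms of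
  degree 9 and 10 on each of the two blocks of degree 4, and the change of partial derivatives adds
  5.\<close>

lemma I10_tangent_form:
  assumes nz: "p * s - q * r \<noteq> 0"
  shows "I10 (tangent_form a b c (linear_form p q) (linear_form r s))
    = (p * s - q * r) ^ 30 * (a ^ 5 * c ^ 5 - 3125 * b ^ 6 * c ^ 4)"
proof -
  let ?f = "tangent_form a b c (linear_form p q) (linear_form r s)"
  let ?L = "[:q, p:]" and ?M = "[:s, r:]" and ?D = "p * s - q * r"
  define G where "G = monom a 5 + monom (5 * b) 4"
  define H where "H = monom b 5 + monom c 0"
  define g where "g = smult p G + smult r H"
  define h where "h = smult q G + smult s H"
  have deg: "degree g \<le> 5" "degree h \<le> 5"
    unfolding g_def h_def G_def H_def
    by (intro degree_add_le order.trans[OF degree_smult_le] order.trans[OF degree_monom_le]; simp)+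
  have fx: "poly (map_poly pderiv ?f) 1 = smult 6 (hom_subst 5 ?L ?M g)"
    using poly_dir_deriv_tangent_form[of 1 0 a b c p q r s] by (simp add: dir_deriv_def g_def G_def H_def)
  have fy: "poly (pderiv ?f) 1 = smult 6 (hom_subst 5 ?L ?M h)"
    using poly_dir_deriv_tangent_form[of 0 1 a b c p q r s] by (simp add: dir_deriv_def h_def G_def H_def)
  let ?S = "sylvester_mat_sub 5 5 (hom_subst 5 ?L ?M g) (hom_subst 5 ?L ?M h)"
  have "I10 ?f = det ?S"
    unfolding I10_def form_discriminant_def form_resultant_def fx fy
    by (simp add: fx fy sylvester_mat_sub_smult)
  have S: "?S \<in> carrier_mat 10 10" using sylvester_mat_sub_carrier[of 5 5] by simp
  have c: "subst_mat k ?L ?M \<in> carrier_mat k k" for k by (simp add: subst_mat_def)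
  have Sgh: "sylvester_mat_sub 5 5 g h \<in> carrier_mat 10 10" using sylvester_mat_sub_carrier[of 5 5] by simp
  let ?B = "four_block_mat (subst_mat 5 ?L ?M) (0\<^sub>m 5 5) (0\<^sub>m 5 5) (subst_mat 5 ?L ?M)"
  have B: "?B \<in> carrier_mat 10 10" using four_block_carrier_mat[OF c[of 5] c[of 5]] by simp
  have "sylvester_mat_sub 5 5 g h * subst_mat 10 ?L ?M = ?B * ?S"
    using sylvester_subst[OF deg, of ?L ?M] by simp
  then have "det (sylvester_mat_sub 5 5 g h) * det (subst_mat 10 ?L ?M) = det ?B * det ?S"
    using det_mult[OF Sgh c] det_mult[OF B S] by simp
  moreover have "det ?B = det (subst_mat 5 ?L ?M) * det (subst_mat 5 ?L ?M)"
    by (rule det_four_block_mat_upper_right_zero[OF c _ _ c]) auto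
  ultimately have "det (sylvester_mat_sub 5 5 g h) * ?D ^ 45 = ?D ^ 20 * det ?S"
    using det_subst_mat[OF nz] by (simp flip: power_add)
  moreover have "x * z ^ 45 = z ^ 20 * y \<Longrightarrow> z \<noteq> 0 \<Longrightarrow> y = x * z ^ 25" for x y z :: complex
  proof -
    assume "x * z ^ 45 = z ^ 20 * y" "z \<noteq> 0"
    moreover have "z ^ 45 = z ^ 20 * z ^ 25" by (simp flip: power_add)
    ultimately have "z ^ 20 * (x * z ^ 25) = z ^ 20 * y" by (simp only: mult.left_commute)
    then show ?thesis using \<open>z \<noteq> 0\<close> by simp
  qed
  ultimately have S: "det ?S = det (sylvester_mat_sub 5 5 g h) * ?D ^ 25" using nz by blast
  let ?C = "four_block_mat (p \<cdot>\<^sub>m 1\<^sub>m 5) (r \<cdot>\<^sub>m 1\<^sub>m 5) (q \<cdot>\<^sub>m 1\<^sub>m 5) (s \<cdot>\<^sub>m 1\<^sub>m 5)"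
  have "?C \<in> carrier_mat (5 + 5) (5 + 5)" by (rule four_block_carrier_mat) auto
  then have "det (sylvester_mat_sub 5 5 g h) = ?D ^ 5 * (a ^ 5 * c ^ 5 - 3125 * b ^ 6 * c ^ 4)"
    unfolding g_def h_def sylvester_mat_sub_linear_combination
    by (subst det_mult[OF _ sylvester_mat_sub_carrier])
      (simp_all add: det_scalar_blocks G_def H_def det_sylvester_normal_form)
  moreover have "z ^ 5 * y * z ^ 25 = z ^ 30 * y" for y z :: complex
    by (simp add: mult_ac flip: power_add)
  ultimately show ?thesis unfolding \<open>I10 ?f = det ?S\<close> S by simp
qed

lemma linear_form_mult_form:
  "linear_form r s * form d b =
    form (Suc d) (\<lambda>i. (of_nat (Suc d - i) * r * b i + of_nat i * s * b (i - 1)) / of_nat (Suc d))"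
proof (intro poly_eqI)
  fix i j
  let ?c = "\<lambda>i. (of_nat (Suc d - i) * r * b i + of_nat i * s * b (i - 1)) / of_nat (Suc d)"
  have 1: "of_nat (Suc d choose j) * of_nat (Suc d - j) = (of_nat (Suc d) * of_nat (d choose j) :: complex)"
    using binomial_absorb_comp[of "Suc d" j] by (metis diff_Suc_1 mult.commute of_nat_mult)
  have 2: "of_nat (Suc d choose Suc k) * of_nat (Suc k) = (of_nat (Suc d) * of_nat (d choose k) :: complex)" for k
    using binomial_absorption[of k "Suc d"] by (metis diff_Suc_1 mult.commute of_nat_mult)
  have "coeff (coeff (linear_form r s * form d b) j) i
      = (if i + j = Suc d then r * of_nat (d choose j) * b j
          + (case j of 0 \<Rightarrow> 0 | Suc k \<Rightarrow> s * of_nat (d choose k) * b k) else 0)"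
    unfolding linear_form_mult by (cases i; cases j) (auto simp: coeff_form coeff_pCons)
  moreover have "of_nat (Suc d choose j) * ?c j = r * of_nat (d choose j) * b j
      + (case j of 0 \<Rightarrow> 0 | Suc k \<Rightarrow> s * of_nat (d choose k) * b k)"
  proof -
    have "of_nat (Suc d choose j) * ?c j
      = (of_nat (Suc d choose j) * of_nat (Suc d - j) * r * b j + of_nat (Suc d choose j) * of_nat j * s * b (j - 1)) / of_nat (Suc d)"
      by (simp add: algebra_simps del: of_nat_Suc binomial_Suc_Suc)
    also have "\<dots> = r * of_nat (d choose j) * b j + (case j of 0 \<Rightarrow> 0 | Suc k \<Rightarrow> s * of_nat (d choose k) * b k)"
    proof (cases j)
      case 0
      then show ?thesis unfolding 1 using of_nat_neq_0[of d, where 'a = complex] by simp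
    next
      case (Suc k)
      show ?thesis unfolding 1 unfolding Suc 2
        using of_nat_neq_0[of d, where 'a = complex] by (simp add: add_divide_distrib del: of_nat_Suc)
    qed
    finally show ?thesis .
  qed
  ultimately show "coeff (coeff (linear_form r s * form d b) j) i = coeff (coeff (form (Suc d) ?c) j) i"
    unfolding coeff_form by (simp only:)
qed

text \<open>The subtractions \<open>5 - i\<close> at i = 6 and \<open>i - 1\<close> at i = 0 are
  truncated, but there the factor \<open>of_nat (6 - i)\<close> or \<open>of_nat i\<close> is
  zero.\<close>

lemma tangent_form_eq_form:
  "tangent_form a b c (linear_form p q) (linear_form r s) =
    form 6 (\<lambda>i. a * (p ^ (6 - i) * q ^ i)
      + b * (of_nat (6 - i) * r * (p ^ (5 - i) * q ^ i) + of_nat i * s * (p ^ (5 - (i - 1)) * q ^ (i - 1)))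
      + c * (r ^ (6 - i) * s ^ i))"
proof -
  let ?T = "\<lambda>i. of_nat (6 - i) * r * (p ^ (5 - i) * q ^ i) + of_nat i * s * (p ^ (5 - (i - 1)) * q ^ (i - 1))"
  have const: "[:[:x:]:] * form 6 t = form 6 (\<lambda>i. x * t i)" for x t by (simp add: form_scale)
  have "linear_form p q ^ 5 * linear_form r s = form 6 (\<lambda>i. ?T i / 6)"
    using linear_form_mult_form[of r s 5 "\<lambda>i. p ^ (5 - i) * q ^ i"]
    by (simp add: linear_form_power[of p q 5] mult.commute)
  then have "[:[:6 * b:]:] * (linear_form p q ^ 5 * linear_form r s) = form 6 (\<lambda>i. b * ?T i)"
    unfolding \<open>linear_form p q ^ 5 * linear_form r s = form 6 (\<lambda>i. ?T i / 6)\<close> const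
    by (intro form_cong) simp
  then show ?thesis
    unfolding tangent_form_def form_add by (simp only: linear_form_power const)
qed

section \<open>The invariants of a sum of three sixth powers\<close>

lemma det_3:
  "det (mat 3 3 f) = (f (0,0) * (f (1,1) * f (2,2) - f (1,2) * f (2,1))
     - f (0,1) * (f (1,0) * f (2,2) - f (1,2) * f (2,0))
     + f (0,2) * (f (1,0) * f (2,1) - f (1,1) * f (2,0)) :: 'a::comm_ring_1)"
proof -
  have 2: "det (mat 2 2 g) = (g (0,0) * g (1,1) - g (0,1) * g (1,0) :: 'a)" for g
    by (subst laplace_expansion_row[of _ 2 0])
      (simp_all add: numeral_2_eq_2 cofactor_def mat_delete_def det_single)
  have "det (mat 3 3 f) = (\<Sum>j<3. f (0, j) * ((-1) ^ j *
      det (mat 2 2 (\<lambda>(i', j'). f (Suc i', if j' < j then j' else Suc j')))))"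
    by (subst laplace_expansion_row[of _ 3 0])
      (auto simp: cofactor_def mat_delete_def intro!: sum.cong arg_cong2[of _ _ _ _ "(*)"]
        arg_cong[of _ _ det] eq_matI)
  then show ?thesis
    unfolding 2 by (simp add: numeral_3_eq_3 numeral_2_eq_2 algebra_simps)
qed

text \<open>The expanded determinant of the 3 by 3 Hankel matrix of \<open>b\<close>, the
  catalecticant of a quartic; I_6 is its value at the b_i.\<close>

definition hankel3 :: "(nat \<Rightarrow> 'a::comm_ring_1) \<Rightarrow> 'a" where
  "hankel3 b = b 0 * (b 2 * b 4 - b 3 * b 3) - b 1 * (b 1 * b 4 - b 3 * b 2)
     + b 2 * (b 1 * b 3 - b 2 * b 2)"

text \<open>The polarizations of the cubic form \<open>hankel3\<close> in bidegree \<open>(2, 1)\<close> and tridegree \<open>(1, 1, 1)\<close>.\<close>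

definition hankel3_polar21 :: "(nat \<Rightarrow> 'a::comm_ring_1) \<Rightarrow> (nat \<Rightarrow> 'a) \<Rightarrow> 'a" where
  "hankel3_polar21 A B =
     A 0 * A 2 * B 4 + A 0 * B 2 * A 4 + B 0 * A 2 * A 4 - B 0 * A 3 ^ 2 - 2 * A 0 * A 3 * B 3
      - 2 * A 1 * B 1 * A 4 - A 1 ^ 2 * B 4
      + 2 * (B 1 * A 2 * A 3 + A 1 * B 2 * A 3 + A 1 * A 2 * B 3) - 3 * A 2 ^ 2 * B 2"

definition hankel3_polar111 ::
    "(nat \<Rightarrow> 'a::comm_ring_1) \<Rightarrow> (nat \<Rightarrow> 'a) \<Rightarrow> (nat \<Rightarrow> 'a) \<Rightarrow> 'a" where
  "hankel3_polar111 A B C =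
     A 0 * B 2 * C 4 + A 0 * C 2 * B 4 + B 0 * A 2 * C 4 + B 0 * C 2 * A 4 + C 0 * A 2 * B 4 + C 0 * B 2 * A 4
      - 2 * (A 0 * B 3 * C 3 + B 0 * A 3 * C 3 + C 0 * A 3 * B 3)
      - 2 * (A 4 * B 1 * C 1 + B 4 * A 1 * C 1 + C 4 * A 1 * B 1)
      + 2 * (A 1 * B 2 * C 3 + A 1 * C 2 * B 3 + B 1 * A 2 * C 3 + B 1 * C 2 * A 3 + C 1 * A 2 * B 3 + C 1 * B 2 * A 3)
      - 6 * A 2 * B 2 * C 2"

text \<open>Polarization reduces the invariant of a sum of three quartics to identities about one,
  two or three of them at a time.\<close>

lemma hankel3_expand:
  "hankel3 (\<lambda>i. m * A i + n * B i + k * C i) =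
     m ^ 3 * hankel3 A + n ^ 3 * hankel3 B + k ^ 3 * hankel3 C
     + m ^ 2 * n * hankel3_polar21 A B + n ^ 2 * m * hankel3_polar21 B A
     + m ^ 2 * k * hankel3_polar21 A C + k ^ 2 * m * hankel3_polar21 C A
     + n ^ 2 * k * hankel3_polar21 B C + k ^ 2 * n * hankel3_polar21 C B
     + m * n * k * hankel3_polar111 A B C"
  unfolding hankel3_def hankel3_polar21_def hankel3_polar111_def
  by (simp add: algebra_simps power2_eq_square power3_eq_cube)

text \<open>Six times the normalized coefficients of the quartic \<open>(p * x + q * y)\<^sup>2 * (r * x + s * y)\<^sup>2\<close>.\<close>

definition sq_prod :: "'a::comm_ring_1 \<Rightarrow> 'a \<Rightarrow> 'a \<Rightarrow> 'a \<Rightarrow> nat \<Rightarrow> 'a" where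
  "sq_prod p q r s i = [6 * (p^2 * r^2), 3 * (p * r * (p * s + r * q)),
     p^2 * s^2 + 4 * p * r * q * s + r^2 * q^2, 3 * (q * s * (p * s + r * q)), 6 * (q^2 * s^2)] ! i"

lemma sq_prod_simps:
  "sq_prod p q r s 0 = 6 * (p^2 * r^2)"
  "sq_prod p q r s 1 = 3 * (p * r * (p * s + r * q))"
  "sq_prod p q r s 2 = p^2 * s^2 + 4 * p * r * q * s + r^2 * q^2"
  "sq_prod p q r s 3 = 3 * (q * s * (p * s + r * q))"
  "sq_prod p q r s 4 = 6 * (q^2 * s^2)"
  by (simp_all add: sq_prod_def eval_nat_numeral)

lemma sq_prod_commute: "sq_prod p q r s = sq_prod r s p q"
  by (simp add: sq_prod_def fun_eq_iff algebra_simps)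

text \<open>The catalecticant is an invariant of weight 6, so the value is determined by the case p
  = s = 1, q = r = 0, where \<open>sq_prod\<close> is 1 at index 2 and 0 elsewhere.\<close>

lemma hankel3_sq_prod:
  "hankel3 (sq_prod p q r s) = - ((p * s - r * q) ^ 6)"
  unfolding hankel3_def sq_prod_simps
  by (simp add: algebra_simps eval_nat_numeral)

lemma hankel3_polar21_sq_prod:
  fixes p q r s t u :: "complex"
  shows "hankel3_polar21 (sq_prod p q r s) (sq_prod p q t u) = - 3 * (p * s - r * q) ^ 4 * (p * u - t * q) ^ 2"
  unfolding hankel3_polar21_def sq_prod_simps by (simp add: algebra_simps eval_nat_numeral)

lemma hankel3_polar111_sq_prod:
  fixes p q r s t u :: "complex"
  shows "hankel3_polar111 (sq_prod p q r s) (sq_prod p q t u) (sq_prod r s t u)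
    = 48 * (p * s - r * q) ^ 2 * (p * u - t * q) ^ 2 * (r * u - t * s) ^ 2"
  unfolding hankel3_polar111_def sq_prod_simps by (simp add: algebra_simps eval_nat_numeral)

text \<open>The constants -1 and -3 of the pure and (2, 1) terms are those of -(X + Y + Z)^3. That
  cube has -6 XYZ where the (1, 1, 1) polarization gives 48 XYZ, whence 54.\<close>

lemma hankel3_three_squares:
  fixes p q r s t u m n k :: "complex"
  defines "X \<equiv> m * (p * s - r * q) ^ 2" and "Y \<equiv> n * (p * u - t * q) ^ 2"
    and "Z \<equiv> k * (r * u - t * s) ^ 2"
  shows "hankel3 (\<lambda>i. m * sq_prod p q r s i + n * sq_prod p q t u i + k * sq_prod r s t u i)
    = 54 * X * Y * Z - (X + Y + Z) ^ 3"
proof -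
  note h = hankel3_polar21_sq_prod
  define x y z where "x = p * s - r * q" and "y = p * u - t * q" and "z = r * u - t * s"
  note xyz = this
  have neg: "r * q - p * s = - x" "t * q - p * u = - y" "t * s - r * u = - z"
    by (simp_all add: xyz)
  have "hankel3_polar21 (sq_prod p q r s) (sq_prod p q t u) = - 3 * x ^ 4 * y ^ 2"
    using h[of p q r s t u] by (simp add: xyz)
  moreover have "hankel3_polar21 (sq_prod p q t u) (sq_prod p q r s) = - 3 * y ^ 4 * x ^ 2"
    using h[of p q t u r s] by (simp add: xyz)
  moreover have "hankel3_polar21 (sq_prod p q r s) (sq_prod r s t u) = - 3 * x ^ 4 * z ^ 2"
    using h[of r s p q t u] by (simp add: neg sq_prod_commute[of r s p q]) (simp add: xyz)
  moreover have "hankel3_polar21 (sq_prod r s t u) (sq_prod p q r s) = - 3 * z ^ 4 * x ^ 2"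
    using h[of r s t u p q] by (simp add: neg sq_prod_commute[of r s p q]) (simp add: xyz)
  moreover have "hankel3_polar21 (sq_prod p q t u) (sq_prod r s t u) = - 3 * y ^ 4 * z ^ 2"
    using h[of t u p q r s]
    by (simp add: neg sq_prod_commute[of t u p q] sq_prod_commute[of t u r s])
  moreover have "hankel3_polar21 (sq_prod r s t u) (sq_prod p q t u) = - 3 * z ^ 4 * y ^ 2"
    using h[of t u r s p q]
    by (simp add: neg sq_prod_commute[of t u p q] sq_prod_commute[of t u r s])
  ultimately show ?thesis
    unfolding hankel3_expand hankel3_sq_prod hankel3_polar111_sq_prod X_def Y_def Z_def xyz[symmetric]
    by (simp add: algebra_simps eval_nat_numeral)
qed

text \<open>Up to constants, I_2 is the sixth transvectant of the sextic with itself and the b_i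
  form the fourth. Both are quadratic and vanish on a single sixth power, so only mixed terms
  remain: for two linear forms with bracket D they are multiples of D^6 and of D^4 times the product
  of their squares.\<close>

lemma sextic_invariants_three_powers:
  fixes p q r s t u m n k :: "complex" and a :: "nat \<Rightarrow> complex"
  assumes a: "\<And>i. i \<le> 6 \<Longrightarrow> a i = l * (p ^ (6 - i) * q ^ i) + m * (r ^ (6 - i) * s ^ i) + n * (t ^ (6 - i) * u ^ i)"
  defines "X \<equiv> l * m * (p * s - r * q) ^ 6" and "Y \<equiv> l * n * (p * u - t * q) ^ 6"
    and "Z \<equiv> m * n * (r * u - t * s) ^ 6"
  defines "M \<equiv> l * m * (p * s - r * q) ^ 4" and "N \<equiv> l * n * (p * u - t * q) ^ 4"
    and "K \<equiv> m * n * (r * u - t * s) ^ 4"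
  defines "B \<equiv> \<lambda>i. M * sq_prod p q r s i + N * sq_prod p q t u i + K * sq_prod r s t u i"
  shows "- 10 * a 3 ^ 2 + 15 * a 2 * a 4 - 6 * a 1 * a 5 + a 0 * a 6 = X + Y + Z"
    "6 * (a 0 * a 4 - 4 * a 1 * a 3 + 3 * a 2 ^ 2) = B 0"
    "3 * (a 0 * a 5 - 3 * a 1 * a 4 + 2 * a 2 * a 3) = B 1"
    "a 0 * a 6 - 9 * a 2 * a 4 + 8 * a 3 ^ 2 = B 2"
    "3 * (a 1 * a 6 - 3 * a 2 * a 5 + 2 * a 3 * a 4) = B 3"
    "6 * (a 2 * a 6 - 4 * a 3 * a 5 + 3 * a 4 ^ 2) = B 4"
proof -
  have a: "a 0 = l * p^6 + m * r^6 + n * t^6" "a 1 = l * (p^5 * q) + m * (r^5 * s) + n * (t^5 * u)"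
    "a 2 = l * (p^4 * q^2) + m * (r^4 * s^2) + n * (t^4 * u^2)"
    "a 3 = l * (p^3 * q^3) + m * (r^3 * s^3) + n * (t^3 * u^3)"
    "a 4 = l * (p^2 * q^4) + m * (r^2 * s^4) + n * (t^2 * u^4)"
    "a 5 = l * (p * q^5) + m * (r * s^5) + n * (t * u^5)" "a 6 = l * q^6 + m * s^6 + n * u^6"
    by (simp_all add: a)
  note defs = X_def Y_def Z_def B_def M_def N_def K_def sq_prod_simps
  show "- 10 * a 3 ^ 2 + 15 * a 2 * a 4 - 6 * a 1 * a 5 + a 0 * a 6 = X + Y + Z"
    "6 * (a 0 * a 4 - 4 * a 1 * a 3 + 3 * a 2 ^ 2) = B 0"
    "3 * (a 0 * a 5 - 3 * a 1 * a 4 + 2 * a 2 * a 3) = B 1"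
    "a 0 * a 6 - 9 * a 2 * a 4 + 8 * a 3 ^ 2 = B 2"
    "3 * (a 1 * a 6 - 3 * a 2 * a 5 + 2 * a 3 * a 4) = B 3"
    "6 * (a 2 * a 6 - 4 * a 3 * a 5 + 3 * a 4 ^ 2) = B 4"
    unfolding a defs by (simp_all add: algebra_simps eval_nat_numeral)
qed

section \<open>Binary sextics\<close>

text \<open>Annihilation is a linear system in the r + 1 coefficients with one equation for each j
  such that j + r is at most d. As d is at most 2r, zero rows can make the matrix square.\<close>

lemma has_apolar_iff_det:
  assumes "d \<le> 2 * r"
  shows "has_apolar d r a \<longleftrightarrow>
    det (mat (Suc r) (Suc r) (\<lambda>(j, i). if j + r \<le> d then a (i + j) else 0)) = 0"
    (is "_ \<longleftrightarrow> det ?A = 0")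
proof -
  have A: "?A \<in> carrier_mat (Suc r) (Suc r)" by simp
  have mv: "(?A *\<^sub>v v) $ j = (if j + r \<le> d then \<Sum>i\<le>r. v $ i * a (i + j) else 0)"
    if "v \<in> carrier_vec (Suc r)" "j < Suc r" for v j
    using that by (auto simp: scalar_prod_def mult.commute atLeast0LessThan lessThan_Suc_atMost intro!: sum.cong)
  show ?thesis
  proof
    assume "has_apolar d r a"
    then obtain c where c: "c \<noteq> 0" "degree c \<le> r" "apolar d r c a" unfolding has_apolar_def by blast
    define v where "v = vec (Suc r) (coeff c)"
    have v: "v \<in> carrier_vec (Suc r)" by (simp add: v_def)
    have "v $ degree c \<noteq> 0" using c by (simp add: v_def)
    then have "v \<noteq> 0\<^sub>v (Suc r)" using c by auto
    moreover have "?A *\<^sub>v v = 0\<^sub>v (Suc r)"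
    proof (rule eq_vecI)
      fix j assume "j < dim_vec (0\<^sub>v (Suc r) :: complex vec)"
      then have j: "j < Suc r" by simp
      have "(\<Sum>i\<le>r. v $ i * a (i + j)) = act c a j"
        unfolding act_eq_sum[OF c(2)] by (rule sum.cong) (auto simp: v_def)
      then show "(?A *\<^sub>v v) $ j = 0\<^sub>v (Suc r) $ j"
        using c(3) j unfolding mv[OF v j] by (simp add: apolar_def)
    qed simp
    ultimately show "det ?A = 0" using det_0_iff_vec_prod_zero[OF A] v by blast
  next
    assume "det ?A = 0"
    then obtain v where v: "v \<in> carrier_vec (Suc r)" "v \<noteq> 0\<^sub>v (Suc r)" "?A *\<^sub>v v = 0\<^sub>v (Suc r)"
      using det_0_iff_vec_prod_zero[OF A] by blast
    define c where "c = (\<Sum>i\<le>r. monom (v $ i) i)"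
    have coeff: "coeff c i = (if i \<le> r then v $ i else 0)" for i unfolding c_def by (simp add: coeff_sum)
    have deg: "degree c \<le> r" by (rule degree_le) (simp add: coeff)
    obtain i where "i \<le> r" "v $ i \<noteq> 0" using v(1,2) by (metis carrier_vecD eq_vecI index_zero_vec less_Suc_eq_le)
    then have "c \<noteq> 0" using coeff by (metis coeff_0)
    moreover have "apolar d r c a"
      unfolding apolar_def
    proof (intro allI impI)
      fix j assume j: "j + r \<le> d"
      then have j': "j < Suc r" using assms by simp
      have "act c a j = (?A *\<^sub>v v) $ j"
        unfolding act_eq_sum[OF deg] mv[OF v(1) j'] using j by (simp add: coeff)
      then show "act c a j = 0" using v(3) j' by simp
    qed
    ultimately show "has_apolar d r a" unfolding has_apolar_def using deg by blast
  qed
qed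

text \<open>The row j = r is one of the added zero rows. For d = 6 and r = 4 this yields the quartic
  annihilator.\<close>

lemma has_apolar_if_large:
  assumes "d < 2 * r"
  shows "has_apolar d r a"
proof -
  let ?A = "mat (Suc r) (Suc r) (\<lambda>(j, i). if j + r \<le> d then a (i + j) else 0)"
  have "det ?A = (\<Sum>i<Suc r. ?A $$ (r, i) * cofactor ?A r i)"
    by (rule laplace_expansion_row) auto
  also have "\<dots> = 0" using assms by (intro sum.neutral) auto
  finally show ?thesis using has_apolar_iff_det assms by simp
qed

section \<open>Evaluating the invariants\<close>

lemma sextic_coeff_eq: "sextic_coeff f = norm_coeff 6 f"
  by (simp add: fun_eq_iff sextic_coeff_def norm_coeff_def)

lemma has_apolar_3_iff_I4: "has_apolar 6 3 (sextic_coeff f) \<longleftrightarrow> I4 f = 0"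
proof -
  have "mat (Suc 3) (Suc 3) (\<lambda>(j, i). if j + 3 \<le> 6 then sextic_coeff f (i + j) else 0)
      = mat 4 4 (\<lambda>(i, j). sextic_coeff f (i + j))"
    by (rule eq_matI) (auto simp: add.commute)
  then show ?thesis by (simp add: has_apolar_iff_det I4_def)
qed

lemma I6_eq_hankel3:
  assumes "6 * (a 0 * a 4 - 4 * a 1 * a 3 + 3 * a 2 ^ 2) = b 0"
    "3 * (a 0 * a 5 - 3 * a 1 * a 4 + 2 * a 2 * a 3) = b 1"
    "a 0 * a 6 - 9 * a 2 * a 4 + 8 * a 3 ^ 2 = b 2"
    "3 * (a 1 * a 6 - 3 * a 2 * a 5 + 2 * a 3 * a 4) = b 3"
    "6 * (a 2 * a 6 - 4 * a 3 * a 5 + 3 * a 4 ^ 2) = b 4"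
    and "a = sextic_coeff f"
  shows "I6 f = hankel3 b"
proof -
  have "[b 0, b 1, b 2, b 3, b 4] ! 2 = b 2" "[b 0, b 1, b 2, b 3, b 4] ! 3 = b 3"
    "[b 0, b 1, b 2, b 3, b 4] ! 4 = b 4" by (simp_all add: eval_nat_numeral)
  then show ?thesis
    unfolding I6_def Let_def assms(6)[symmetric] assms(1-5) det_3 hankel3_def
    by (simp add: numeral_2_eq_2[symmetric] numeral_3_eq_3[symmetric])
qed

text \<open>The weights carry fourth powers of brackets, which the squares in
  \<open>hankel3_three_squares\<close> complete to sixth powers. So X + Y + Z is I_2 and its cube
  cancels.\<close>

lemma I2_I6_three_powers:
  assumes a: "\<And>i. i \<le> 6 \<Longrightarrow> sextic_coeff f i
    = l * (p ^ (6 - i) * q ^ i) + m * (r ^ (6 - i) * s ^ i) + n * (t ^ (6 - i) * u ^ i)"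
  shows "I2 f ^ 3 + I6 f = 54 * (l * m * (p * s - r * q) ^ 6) * (l * n * (p * u - t * q) ^ 6) * (m * n * (r * u - t * s) ^ 6)"
proof -
  have 6: "x * z ^ 4 * z ^ 2 = x * z ^ 6" for x z :: complex by (simp add: mult.assoc flip: power_add)
  note inv = sextic_invariants_three_powers[of "sextic_coeff f", OF a]
  have "I2 f = l * m * (p * s - r * q) ^ 6 + l * n * (p * u - t * q) ^ 6 + m * n * (r * u - t * s) ^ 6"
    unfolding I2_def Let_def by (rule inv(1))
  moreover have "I6 f = hankel3 (\<lambda>i. l * m * (p * s - r * q) ^ 4 * sq_prod p q r s i
      + l * n * (p * u - t * q) ^ 4 * sq_prod p q t u i + m * n * (r * u - t * s) ^ 4 * sq_prod r s t u i)"
    by (rule I6_eq_hankel3[OF inv(2-6) refl])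
  ultimately show ?thesis unfolding hankel3_three_squares 6 by simp
qed

lemma sextic_coeff_tangent_form:
  assumes "i \<le> 6"
  shows "sextic_coeff (tangent_form a b c (linear_form p q) (linear_form r s)) i
    = a * (p ^ (6 - i) * q ^ i)
      + b * (of_nat (6 - i) * r * (p ^ (5 - i) * q ^ i) + of_nat i * s * (p ^ (5 - (i - 1)) * q ^ (i - 1)))
      + c * (r ^ (6 - i) * s ^ i)"
  unfolding sextic_coeff_eq tangent_form_eq_form norm_coeff_form[OF assms] ..

lemma I2_tangent_form:
  "I2 (tangent_form a b c (linear_form p q) (linear_form r s)) = a * c * (p * s - q * r) ^ 6"
proof -
  have e: "sextic_coeff (tangent_form a b c (linear_form p q) (linear_form r s)) 0 = a * p ^ 6 + b * (6 * r * p ^ 5) + c * r ^ 6"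
    "sextic_coeff (tangent_form a b c (linear_form p q) (linear_form r s)) 1 = a * (p ^ 5 * q) + b * (5 * r * (p ^ 4 * q) + s * p ^ 5) + c * (r ^ 5 * s)"
    "sextic_coeff (tangent_form a b c (linear_form p q) (linear_form r s)) 2 = a * (p ^ 4 * q ^ 2) + b * (4 * r * (p ^ 3 * q ^ 2) + 2 * s * (p ^ 4 * q)) + c * (r ^ 4 * s ^ 2)"
    "sextic_coeff (tangent_form a b c (linear_form p q) (linear_form r s)) 3 = a * (p ^ 3 * q ^ 3) + b * (3 * r * (p ^ 2 * q ^ 3) + 3 * s * (p ^ 3 * q ^ 2)) + c * (r ^ 3 * s ^ 3)"
    "sextic_coeff (tangent_form a b c (linear_form p q) (linear_form r s)) 4 = a * (p ^ 2 * q ^ 4) + b * (2 * r * (p * q ^ 4) + 4 * s * (p ^ 2 * q ^ 3)) + c * (r ^ 2 * s ^ 4)"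
    "sextic_coeff (tangent_form a b c (linear_form p q) (linear_form r s)) 5 = a * (p * q ^ 5) + b * (r * q ^ 5 + 5 * s * (p * q ^ 4)) + c * (r * s ^ 5)"
    "sextic_coeff (tangent_form a b c (linear_form p q) (linear_form r s)) 6 = a * q ^ 6 + b * (6 * s * q ^ 5) + c * s ^ 6"
    by (simp_all add: sextic_coeff_tangent_form)
  show ?thesis unfolding I2_def Let_def e by (simp add: algebra_simps eval_nat_numeral)
qed

section \<open>Annihilators with given linear factors\<close>

text \<open>For pairwise nonparallel factors the recurrences have no resonance, so limits do not
  enter. The factor [:P, Q:] belongs to the direction (Q, -P).\<close>

lemma apolar_prod_imp_power_rep:
  assumes "\<And>i j. i < j \<Longrightarrow> j < r \<Longrightarrow> P i * Q j \<noteq> Q i * P j" "\<And>k. k < r \<Longrightarrow> (P k, Q k) \<noteq> (0, 0)"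
    and "r \<le> d" "apolar d r (\<Prod>k<r. [:P k, Q k:]) a"
  shows "power_rep d r Q (\<lambda>k. - P k) a"
  using assms
proof (induction r arbitrary: d a)
  case 0
  then show ?case by (simp add: power_rep_def apolar_def)
next
  case (Suc r)
  then obtain e where e: "d = Suc e" by (cases d) auto
  let ?z = "[:P r, Q r:]"
  have "power_rep e r Q (\<lambda>k. - P k) (act ?z a)"
  proof (rule Suc.IH)
    show "apolar e r (\<Prod>k<r. [:P k, Q k:]) (act ?z a)"
      using Suc.prems(4) e unfolding apolar_act_iff[of e r _ ?z a 1] by simp
  qed (use Suc.prems e in auto)
  then show ?case
    unfolding e
  proof (rule power_rep_Suc)
    fix k assume "k < r"
    then show "P r * Q k + Q r * - P k \<noteq> 0" using Suc.prems(1)[of k r] by (simp add: mult.commute)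
  qed (use Suc.prems(2) in auto)
qed

lemma apolar_const_mult:
  assumes "apolar d r (c * c') a" "degree c' = 0" "c' \<noteq> 0"
  shows "apolar d r c (a :: nat \<Rightarrow> 'a::idom)"
proof -
  obtain x where x: "c' = [:x:]" "x \<noteq> 0" using assms by (metis degree_0_id pCons_eq_0_iff)
  then have "act (c * c') a j = x * act c a j" for j by (simp add: act_smult)
  then show ?thesis using assms(1) x by (auto simp: apolar_def)
qed

text \<open>There are always exactly r factors: roots at infinity give factors with
  \<open>Q k = 0\<close>, and the remaining constant is dropped.\<close>

lemma has_apolar_linear_factors:
  assumes "has_apolar d r a"
  obtains P Q where "\<And>k. k < r \<Longrightarrow> (P k, Q k) \<noteq> (0, 0)" "apolar d r (\<Prod>k<r. [:P k, Q k:]) a"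
proof -
  have "\<exists>P Q c'. (\<forall>k<r. (P k, Q k) \<noteq> (0, 0)) \<and> c = (\<Prod>k<r. [:P k, Q k:]) * c' \<and> degree c' = 0 \<and> c' \<noteq> 0"
    if "c \<noteq> 0" "degree c \<le> r" for c :: "complex poly"
    using that
  proof (induction r arbitrary: c)
    case (Suc r)
    obtain p q c1 where z: "(p, q) \<noteq> (0, 0)" "c = [:p, q:] * c1" "c1 \<noteq> 0" "degree c1 \<le> r"
      using poly_root_factor Suc.prems by metis
    obtain P Q c' where IH: "\<And>k. k < r \<Longrightarrow> (P k, Q k) \<noteq> (0, 0)" "c1 = (\<Prod>k<r. [:P k, Q k:]) * c'"
      "degree c' = 0" "c' \<noteq> 0"
      using Suc.IH[OF z(3,4)] by blast
    have "c = (\<Prod>k<Suc r. [:(P(r := p)) k, (Q(r := q)) k:]) * c'"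
      unfolding z(2) IH(2) by (simp add: mult_ac del: mult_pCons_left mult_pCons_right)
    moreover have "((P(r := p)) k, (Q(r := q)) k) \<noteq> (0, 0)" if "k < Suc r" for k
      using that z(1) IH(1)[of k] by (cases "k = r") auto
    ultimately show ?case using IH(3,4) by blast
  qed simp
  then obtain c P Q c' where "apolar d r c a" "\<forall>k<r. (P k, Q k) \<noteq> (0, 0)"
    "c = (\<Prod>k<r. [:P k, Q k:]) * c'" "degree c' = 0" "c' \<noteq> 0"
    using assms unfolding has_apolar_def by blast
  then show ?thesis
    using that[of P Q] apolar_const_mult[of d r "\<Prod>k<r. [:P k, Q k:]" c' a] by simp
qed

lemma parallel_linear:
  fixes p q u v :: "'a::field"
  assumes "p * v = q * u" "(p, q) \<noteq> (0, 0)"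
  shows "\<exists>t. [:u, v:] = smult t [:p, q:]"
proof (cases "p = 0")
  case True
  then show ?thesis using assms by (intro exI[of _ "v / q"]) auto
next
  case False
  then show ?thesis using assms by (intro exI[of _ "u / p"]) (simp add: field_simps)
qed

lemma power_sum_2I:
  assumes "\<And>i. i \<le> d \<Longrightarrow> a i = x * (p ^ (d - i) * q ^ i) + y * (r ^ (d - i) * s ^ i)"
    and "(p, q) \<noteq> (0, 0)" "(r, s) \<noteq> (0, 0)"
  shows "power_sum d 2 a"
  by (rule power_sumI[of 2 "\<lambda>k. if k = 0 then p else r" "\<lambda>k. if k = 0 then q else s" d a "\<lambda>k. if k = 0 then x else y"])
    (use assms in \<open>auto simp: numeral_2_eq_2\<close>)

text \<open>By \<open>apolar_linear_power_le\<close> an annihilator of degree d - m would turn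
  [:p, q:]^(d-m) into one and so raise the multiplicity to m + 1. The degrees d + 1 - m and d - m
  add up to at most d + 1 because d is at most 2m.\<close>

lemma border_rank_of_root_mult:
  assumes "f \<in> binary_forms d" "f \<noteq> 0" "has_root_of_mult f m" "m \<le> d" "d \<le> 2 * m" "0 < m"
  shows "border_rank d f = Suc d - m"
proof -
  let ?a = "norm_coeff d f"
  have f: "form d ?a = f" by (rule form_norm_coeff[OF assms(1)])
  obtain p q where pq: "(p, q) \<noteq> (0, 0)" and mult: "root_mult f p q = m"
    using assms(3) unfolding has_root_of_mult_def by blast
  note iff = root_mult_ge_iff[OF pq, of d ?a, unfolded f mult, OF assms(2)]
  have yes: "apolar d (Suc d - m) ([:p, q:] ^ (Suc d - m)) ?a" using iff[of m] assms(4) by simp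
  have no: "\<not> apolar d (d - m) ([:p, q:] ^ (d - m)) ?a" using iff[of "Suc m"] assms(4) by simp
  show ?thesis
  proof (rule border_rank_eqI[OF _ assms(1,2)])
    show "d > 0" using assms(4,6) by simp
    show "has_apolar d (Suc d - m) ?a"
      unfolding has_apolar_def
      using yes pq by (intro exI[of _ "[:p, q:] ^ (Suc d - m)"]) (auto intro: order.trans[OF degree_power_le])
    show "\<not> has_apolar d (Suc d - m - 1) ?a"
    proof
      assume "has_apolar d (Suc d - m - 1) ?a"
      then obtain c where "c \<noteq> 0" "degree c \<le> d - m" "apolar d (d - m) c ?a"
        unfolding has_apolar_def by auto
      then have "apolar d (d - m) ([:p, q:] ^ (d - m)) ?a"
        using apolar_linear_power_le[OF pq yes] assms(4,5) by auto
      then show False using no by simp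
    qed
  qed
qed

section \<open>Stable sextics\<close>

text \<open>Multiplied up to degree 4, such an annihilator would mean a root of multiplicity at
  least 7 - 4 = 3.\<close>

lemma stable_sextic_not_apolar:
  assumes "f \<in> binary_forms 6" "f \<noteq> 0" "stable_sextic f" "(p, q) \<noteq> (0, 0)" "k \<le> 4"
  shows "\<not> apolar 6 k ([:p, q:] ^ k) (sextic_coeff f)"
proof
  assume "apolar 6 k ([:p, q:] ^ k) (sextic_coeff f)"
  then have "apolar 6 (k + (4 - k)) ([:p, q:] ^ k * [:p, q:] ^ (4 - k)) (sextic_coeff f)"
    by (rule apolar_mult) (auto intro: order.trans[OF degree_power_le])
  then have "apolar 6 4 ([:p, q:] ^ 4) (norm_coeff 6 f)"
    using assms(5) by (simp add: sextic_coeff_eq flip: power_add)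
  then have "3 \<le> root_mult f p q"
    using root_mult_ge_iff[OF assms(4), of 6 "norm_coeff 6 f" 3] assms(2) by (simp add: form_norm_coeff[OF assms(1)])
  moreover have "root_mult f p q \<le> 2"
    by (rule assms(3)[unfolded stable_sextic_def, rule_format, OF assms(4)])
  ultimately show False by simp
qed

text \<open>By stability the quadratic annihilator has distinct roots, so \<open>f\<close> is a
  combination of two sixth powers: a sum of three with one scalar 0, and also a tangential form with
  b = 0.\<close>

lemma stable_has_apolar_2:
  assumes f: "f \<in> binary_forms 6" "f \<noteq> 0" "stable_sextic f" and A: "has_apolar 6 2 (sextic_coeff f)"
  shows "I2 f ^ 3 + I6 f = 0 \<and> I2 f ^ 5 = I10 f"
proof -
  let ?a = "sextic_coeff f"
  obtain P Q :: "nat \<Rightarrow> complex" where nz: "\<And>k. k < 2 \<Longrightarrow> (P k, Q k) \<noteq> (0, 0)" and ap: "apolar 6 2 (\<Prod>k<2. [:P k, Q k:]) ?a"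
    by (rule has_apolar_linear_factors[OF A]) blast
  have ap': "apolar 6 2 ([:P 0, Q 0:] * [:P 1, Q 1:]) ?a"
    using ap by (simp add: numeral_2_eq_2 del: mult_pCons_left mult_pCons_right)
  have nonpar: "P 0 * Q 1 \<noteq> Q 0 * P 1"
  proof
    assume par: "P 0 * Q 1 = Q 0 * P 1"
    have "(P 0, Q 0) \<noteq> (0, 0)" by (rule nz) simp
    then obtain t where t: "[:P 1, Q 1:] = smult t [:P 0, Q 0:]"
      using parallel_linear[OF par] by blast
    then have "t \<noteq> 0" using nz[of 1] by auto
    have "act ([:P 0, Q 0:] * [:P 1, Q 1:]) ?a j = t * act ([:P 0, Q 0:] ^ 2) ?a j" for j
      unfolding t mult_smult_right act_smult power2_eq_square ..
    then have "apolar 6 2 ([:P 0, Q 0:] ^ 2) ?a" using ap' \<open>t \<noteq> 0\<close> unfolding apolar_def by simp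
    then show False using stable_sextic_not_apolar[OF f, of "P 0" "Q 0" 2] nz[of 0] by simp
  qed
  have "power_rep 6 2 Q (\<lambda>k. - P k) ?a"
    by (rule apolar_prod_imp_power_rep[OF _ nz _ ap]) (use nonpar in \<open>auto simp: less_2_cases_iff\<close>)
  then obtain m where m: "\<And>i. i \<le> 6 \<Longrightarrow> ?a i = (\<Sum>k<2. m k * (Q k ^ (6 - i) * (- P k) ^ i))"
    unfolding power_rep_def by blast
  then have a: "?a i = m 0 * (Q 0 ^ (6 - i) * (- P 0) ^ i) + m 1 * (Q 1 ^ (6 - i) * (- P 1) ^ i)" if "i \<le> 6" for i
    using that by (simp add: numeral_2_eq_2)
  have "I2 f ^ 3 + I6 f = 0"
    using I2_I6_three_powers[of f "m 0" "Q 0" "- P 0" "m 1" "Q 1" "- P 1" 0 0 0] a by simp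
  moreover have f_eq: "f = tangent_form (m 0) 0 (m 1) (linear_form (Q 0) (- P 0)) (linear_form (Q 1) (- P 1))"
  proof -
    have "form 6 (norm_coeff 6 f) = tangent_form (m 0) 0 (m 1) (linear_form (Q 0) (- P 0)) (linear_form (Q 1) (- P 1))"
      unfolding tangent_form_eq_form by (rule form_cong) (use a in \<open>simp add: sextic_coeff_eq\<close>)
    then show ?thesis by (simp add: form_norm_coeff[OF f(1)])
  qed
  have "Q 0 * (- P 1) - (- P 0) * Q 1 \<noteq> 0" using nonpar by (simp add: mult.commute)
  from I10_tangent_form[OF this, of "m 0" 0 "m 1"]
  have "I2 f ^ 5 = I10 f"
    unfolding f_eq I2_tangent_form by (simp add: power_mult_distrib flip: power_mult)
  ultimately show ?thesis by simp
qed

lemma tangent_form_decomposition: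
  assumes ap: "apolar 6 3 ([:p, q:] * ([:p, q:] * [:u, v:])) a" and nonpar: "p * v \<noteq> q * u"
  obtains x y z where "form 6 a = tangent_form x y z (linear_form q (- p)) (linear_form v (- u))"
proof -
  let ?z = "[:p, q:]" and ?w = "[:u, v:]"
  define D where "D = p * v - q * u"
  have D: "D \<noteq> 0" using nonpar by (simp add: D_def)
  have "apolar 5 2 (?z * ?w) (act ?z a)"
    using ap unfolding apolar_act_iff[of 5 2 _ ?z a 1] by (simp add: mult.commute del: mult_pCons_left mult_pCons_right)
  moreover have "(\<Prod>k<(2::nat). [:(if k = 0 then p else u), (if k = 0 then q else v):]) = ?z * ?w"
    by (simp add: numeral_2_eq_2 del: mult_pCons_left mult_pCons_right)
  ultimately have "power_rep 5 2 (\<lambda>k. if k = 0 then q else v) (\<lambda>k. - (if k = 0 then p else u)) (act ?z a)"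
    by (intro apolar_prod_imp_power_rep) (use nonpar in \<open>auto simp: less_2_cases_iff\<close>)
  then obtain m where m: "\<And>i. i \<le> 5 \<Longrightarrow> act ?z a i
      = (\<Sum>k<2. m k * ((if k = (0::nat) then q else v) ^ (5 - i) * (- (if k = 0 then p else u)) ^ i))"
    unfolding power_rep_def by blast
  then have m: "p * a i + q * a (Suc i) = m 0 * (q ^ (5 - i) * (- p) ^ i) + m 1 * (v ^ (5 - i) * (- u) ^ i)"
    if "i \<le> 5" for i using that by (simp add: numeral_2_eq_2)
  \<comment> \<open>The power with scalar \<open>m 0\<close> lies in the kernel of [:p, q:], so it
    does not lift by division. \<open>T\<close> solves this resonant case; it is six times the
    coefficient sequence of l^5 m for l = \<open>linear_form q (- p)\<close> and m =
    \<open>linear_form v (- u)\<close>.\<close>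
  define T where "T i = of_nat (6 - i) * v * (q ^ (5 - i) * (- p) ^ i)
    + of_nat i * (- u) * (q ^ (5 - (i - 1)) * (- p) ^ (i - 1))" for i
  define M where "M i = v ^ (6 - i) * (- u) ^ i" for i
  have T: "p * T i + q * T (Suc i) = D * (q ^ (5 - i) * (- p) ^ i)" if "i \<le> 5" for i
  proof -
    from that consider "i = 0" | "i = 1" | "i = 2" | "i = 3" | "i = 4" | "i = 5" by linarith
    then show ?thesis by cases (simp_all add: T_def D_def algebra_simps eval_nat_numeral)
  qed
  have M: "p * M i + q * M (Suc i) = D * (v ^ (5 - i) * (- u) ^ i)" if "i \<le> 5" for i
    using act_linear_power[of i 6 p v "- u" q] that by (simp add: M_def D_def)
  have pq: "(p, q) \<noteq> (0, 0)" using nonpar by auto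
  define b where "b i = a i - (m 0 / D * T i + m 1 / D * M i)" for i
  have "p * b i + q * b (Suc i) = 0" if "i < 6" for i
  proof -
    have "p * b i + q * b (Suc i) = (p * a i + q * a (Suc i))
      - (m 0 / D * (p * T i + q * T (Suc i)) + m 1 / D * (p * M i + q * M (Suc i)))"
      by (simp add: b_def algebra_simps)
    then show ?thesis using m[of i] T[of i] M[of i] that D by simp
  qed
  then obtain l where l: "\<And>i. i \<le> 6 \<Longrightarrow> b i = l * (q ^ (6 - i) * (- p) ^ i)"
    by (rule act_linear_eq_0_imp_power[OF pq]) blast+
  have "form 6 a = tangent_form l (m 0 / D) (m 1 / D) (linear_form q (- p)) (linear_form v (- u))"
    unfolding tangent_form_eq_form
  proof (rule form_cong)
    fix i :: nat assume "i \<le> 6"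
    then show "a i = l * (q ^ (6 - i) * (- p) ^ i)
      + m 0 / D * (of_nat (6 - i) * v * (q ^ (5 - i) * (- p) ^ i) + of_nat i * (- u) * (q ^ (5 - (i - 1)) * (- p) ^ (i - 1)))
      + m 1 / D * (v ^ (6 - i) * (- u) ^ i)"
      using l[of i] unfolding b_def T_def M_def by (simp add: algebra_simps)
  qed
  then show ?thesis by (rule that)
qed

text \<open>If the scalar \<open>y\<close> of the mixed term were 0, two sixth powers would remain;
  if \<open>z\<close> were 0, the fifth power of a linear form would divide \<open>f\<close>. Either
  way there would be a quadratic annihilator.\<close>

lemma tangent_form_I10_ne:
  assumes f: "f \<in> binary_forms 6" and no: "\<not> has_apolar 6 2 (sextic_coeff f)"
    and ap: "apolar 6 3 ([:p, q:] * ([:p, q:] * [:u, v:])) (sextic_coeff f)" and nonpar: "p * v \<noteq> q * u"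
  shows "I2 f ^ 5 \<noteq> I10 f"
proof -
  let ?l = "linear_form q (- p)" and ?m = "linear_form v (- u)"
  obtain x y z where eq: "form 6 (norm_coeff 6 f) = tangent_form x y z ?l ?m"
    using tangent_form_decomposition[OF ap nonpar] unfolding sextic_coeff_eq by blast
  then have f_eq: "f = tangent_form x y z ?l ?m" by (simp add: form_norm_coeff[OF f])
  have pq: "(p, q) \<noteq> (0, 0)" "(u, v) \<noteq> (0, 0)" using nonpar by auto
  have a: "sextic_coeff f i = x * (q ^ (6 - i) * (- p) ^ i)
      + y * (of_nat (6 - i) * v * (q ^ (5 - i) * (- p) ^ i) + of_nat i * (- u) * (q ^ (5 - (i - 1)) * (- p) ^ (i - 1)))
      + z * (v ^ (6 - i) * (- u) ^ i)" if "i \<le> 6" for i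
    unfolding f_eq by (rule sextic_coeff_tangent_form[OF that])
  have y: "y \<noteq> 0"
  proof
    assume "y = 0"
    then have "power_sum 6 2 (sextic_coeff f)"
      by (intro power_sum_2I[of _ _ x q "- p" z v "- u"]) (use a pq in auto)
    then show False using no power_sum_imp_has_apolar by blast
  qed
  have z: "z \<noteq> 0"
  proof
    assume "z = 0"
    then have "tangent_form x y z ?l ?m = ?l ^ 5 * ([:[:x:]:] * ?l + [:[:6 * y:]:] * ?m)"
      by (simp only: tangent_form_def) (simp add: algebra_simps eval_nat_numeral)
    then have "?l ^ 5 dvd form 6 (norm_coeff 6 f)" using eq by simp
    then have "apolar 6 2 ([:p, q:] ^ 2) (sextic_coeff f)"
      using linear_form_power_dvd_iff_apolar[OF pq(1), of 5 6] by (simp add: sextic_coeff_eq)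
    then have "has_apolar 6 2 (sextic_coeff f)"
      unfolding has_apolar_def using pq(1)
      by (intro exI[of _ "[:p, q:] ^ 2"]) (auto intro: order.trans[OF degree_power_le])
    then show False using no by simp
  qed
  have D: "q * (- u) - (- p) * v \<noteq> 0" using nonpar by simp
  have "I2 f ^ 5 - I10 f = (q * (- u) - (- p) * v) ^ 30 * (3125 * y ^ 6 * z ^ 4)"
    unfolding f_eq I2_tangent_form I10_tangent_form[OF D]
    by (simp add: power_mult_distrib algebra_simps flip: power_mult)
  then show ?thesis using D y z by auto
qed

text \<open>Distinct roots of the cubic annihilator are impossible: the invariants force one of the
  three scalars to vanish, which leaves two powers and a quadratic annihilator. A triple root
  contradicts stability. So there is a double root and the sextic is tangential.\<close>

lemma stable_not_has_apolar_2:
  assumes f: "f \<in> binary_forms 6" "f \<noteq> 0" "stable_sextic f" and no: "\<not> has_apolar 6 2 (sextic_coeff f)"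
    and A: "has_apolar 6 3 (sextic_coeff f)" and inv: "I2 f ^ 3 + I6 f = 0"
  shows "I2 f ^ 5 \<noteq> I10 f"
proof -
  let ?a = "sextic_coeff f"
  obtain P Q :: "nat \<Rightarrow> complex" where nz: "\<And>k. k < 3 \<Longrightarrow> (P k, Q k) \<noteq> (0, 0)" and ap: "apolar 6 3 (\<Prod>k<3. [:P k, Q k:]) ?a"
    by (rule has_apolar_linear_factors[OF A]) blast
  define L where "L k = [:P k, Q k:]" for k
  have ap': "apolar 6 3 (L 0 * L 1 * L 2) ?a"
    using ap by (simp add: L_def[symmetric] eval_nat_numeral)
  define par where "par i j \<longleftrightarrow> P i * Q j = Q i * P j" for i j
  \<comment> \<open>Any parallel pair of factors can be moved to the front; the root of
    \<open>L i\<close> is then double or triple, depending on \<open>L k\<close>.\<close>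
  have two: "I2 f ^ 5 \<noteq> I10 f" if h: "i < 3" "j < 3" "k < 3" "L 0 * L 1 * L 2 = L i * (L j * L k)" "par i j" for i j k
  proof -
    obtain t where t: "L j = smult t (L i)"
      using parallel_linear[OF h(5)[unfolded par_def] nz[OF h(1)]] unfolding L_def by blast
    then have t0: "t \<noteq> 0" using nz[OF h(2)] by (auto simp: L_def)
    have "act (L 0 * L 1 * L 2) ?a n = t * act (L i * (L i * L k)) ?a n" for n
      unfolding h(4) t mult_smult_left mult_smult_right act_smult ..
    then have ap2: "apolar 6 3 (L i * (L i * L k)) ?a" using ap' t0 unfolding apolar_def by auto
    show ?thesis
    proof (cases "P i * Q k = Q i * P k")
      case False
      then show ?thesis using tangent_form_I10_ne[OF f(1) no ap2[unfolded L_def]] by blast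
    next
      case True
      then obtain t' where t': "L k = smult t' (L i)"
        using parallel_linear[OF True nz[OF h(1)]] unfolding L_def by blast
      then have "t' \<noteq> 0" using nz[OF h(3)] by (auto simp: L_def)
      have "act (L i * (L i * L k)) ?a n = t' * act (L i ^ 3) ?a n" for n
        unfolding t' mult_smult_right act_smult power3_eq_cube mult.assoc ..
      then have "apolar 6 3 (L i ^ 3) ?a" using ap2 \<open>t' \<noteq> 0\<close> unfolding apolar_def by auto
      then show ?thesis
        using stable_sextic_not_apolar[OF f nz[OF h(1)], of 3] by (simp add: L_def)
    qed
  qed
  show ?thesis
  proof (cases "par 0 1 \<or> par 0 2 \<or> par 1 2")
    case True
    then show ?thesis
      using two[of 0 1 2] two[of 0 2 1] two[of 1 2 0] by (auto simp: mult_ac)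
  next
    case False
    have "power_rep 6 3 Q (\<lambda>k. - P k) ?a"
    proof (rule apolar_prod_imp_power_rep[OF _ nz _ ap])
      fix i j :: nat assume "i < j" "j < 3"
      then consider "i = 0" "j = 1" | "i = 0" "j = 2" | "i = 1" "j = 2" by linarith
      then show "P i * Q j \<noteq> Q i * P j" by cases (use False in \<open>auto simp: par_def\<close>)
    qed auto
    then obtain m where m: "\<And>i. i \<le> 6 \<Longrightarrow> ?a i = (\<Sum>k<3. m k * (Q k ^ (6 - i) * (- P k) ^ i))"
      unfolding power_rep_def by blast
    have a: "?a i = m 0 * (Q 0 ^ (6 - i) * (- P 0) ^ i) + m 1 * (Q 1 ^ (6 - i) * (- P 1) ^ i)
        + m 2 * (Q 2 ^ (6 - i) * (- P 2) ^ i)" if "i \<le> 6" for i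
      using m[OF that] by (simp add: eval_nat_numeral)
    have nzp: "Q i * (- P j) - Q j * (- P i) \<noteq> 0" if "\<not> par i j" for i j
      using that by (simp add: par_def mult.commute)
    have "m 0 = 0 \<or> m 1 = 0 \<or> m 2 = 0"
      using I2_I6_three_powers[OF a] inv False nzp[of 0 1] nzp[of 0 2] nzp[of 1 2] by auto
    moreover have nzv: "(Q k, - P k) \<noteq> (0, 0)" if "k < 3" for k using nz[OF that] by auto
    ultimately have "power_sum 6 2 ?a"
      using power_sum_2I[of 6 ?a "m 1" "Q 1" "- P 1" "m 2" "Q 2" "- P 2"]
        power_sum_2I[of 6 ?a "m 0" "Q 0" "- P 0" "m 2" "Q 2" "- P 2"]
        power_sum_2I[of 6 ?a "m 0" "Q 0" "- P 0" "m 1" "Q 1" "- P 1"] a nzv[of 0] nzv[of 1] nzv[of 2]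
      by (elim disjE) simp_all
    then show ?thesis using no power_sum_imp_has_apolar by blast
  qed
qed

theorem theorem5p1:
  fixes f :: "complex poly poly"
  assumes "f \<in> binary_forms 6" and "f \<noteq> 0"
  shows "(has_root_of_mult f 6 \<longleftrightarrow> border_rank 6 f = 1)
    \<and> (has_root_of_mult f 5 \<longrightarrow> border_rank 6 f = 2)
    \<and> (has_root_of_mult f 4 \<longrightarrow> border_rank 6 f = 3)
    \<and> (has_root_of_mult f 3 \<longrightarrow> border_rank 6 f = 4)
    \<and> (stable_sextic f \<and> I4 f \<noteq> 0 \<longrightarrow> border_rank 6 f = 4)
    \<and> (stable_sextic f \<and> I4 f = 0 \<and> I2 f ^ 3 + I6 f \<noteq> 0 \<longrightarrow> border_rank 6 f = 3)
    \<and> (stable_sextic f \<and> I4 f = 0 \<and> I2 f ^ 3 + I6 f = 0 \<longrightarrow>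
         (I2 f ^ 5 - I10 f = 0 \<and> border_rank 6 f = 2) \<or>
         (I2 f ^ 5 - I10 f \<noteq> 0 \<and> border_rank 6 f = 3))"
proof -
  let ?A = "\<lambda>r. has_apolar 6 r (sextic_coeff f)"
  have brank: "border_rank 6 f = r" if "?A r" "\<not> ?A (r - 1)" for r
    using border_rank_eqI[OF _ assms] that by (simp add: sextic_coeff_eq)
  have mult: "border_rank 6 f = 7 - m" if "has_root_of_mult f m" "3 \<le> m" "m \<le> 6" for m
    using border_rank_of_root_mult[OF assms that(1)] that(2,3) by simp
  have A1: "\<exists>p q. (p, q) \<noteq> (0, 0) \<and> apolar 6 1 [:p, q:] (sextic_coeff f)" if A: "?A 1"
  proof -
    obtain P Q :: "nat \<Rightarrow> complex" where "\<And>k. k < 1 \<Longrightarrow> (P k, Q k) \<noteq> (0, 0)" "apolar 6 1 (\<Prod>k<1. [:P k, Q k:]) (sextic_coeff f)"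
      by (rule has_apolar_linear_factors[OF A]) blast
    then show ?thesis by (intro exI[of _ "P 0"] exI[of _ "Q 0"]) simp
  qed
  have one: "has_root_of_mult f 6" if "border_rank 6 f = 1"
  proof -
    have "?A 1" using has_apolar_border_rank[OF _ assms] that by (simp add: sextic_coeff_eq)
    then obtain p q where pq: "(p, q) \<noteq> (0, 0)" and ap: "apolar 6 1 [:p, q:] (norm_coeff 6 f)"
      using A1 by (auto simp: sextic_coeff_eq)
    have f: "form 6 (norm_coeff 6 f) = f" by (rule form_norm_coeff[OF assms(1)])
    note iff = root_mult_ge_iff[OF pq, of 6 "norm_coeff 6 f", unfolded f, OF assms(2)]
    have "6 \<le> root_mult f p q" using iff[of 6] ap by simp
    \<comment> \<open>Multiplicity 7 would mean an annihilator of degree 0, hence f = 0.\<close>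
    moreover have "\<not> 7 \<le> root_mult f p q"
      using iff[of 7] f assms(2) form_eq_0_iff[of 6 "norm_coeff 6 f"] by (auto simp: apolar_def)
    ultimately show ?thesis unfolding has_root_of_mult_def using pq by (intro exI[of _ p] exI[of _ q]) simp
  qed
  have not1: "\<not> ?A 1" if st: "stable_sextic f"
  proof
    assume "?A 1"
    then obtain p q where "(p, q) \<noteq> (0, 0)" "apolar 6 1 [:p, q:] (sextic_coeff f)" using A1 by blast
    then show False using stable_sextic_not_apolar[OF assms st, of p q 1] by simp
  qed
  have "border_rank 6 f = 4" if "I4 f \<noteq> 0"
    using that by (intro brank) (simp_all add: has_apolar_if_large has_apolar_3_iff_I4)
  moreover have "border_rank 6 f = 3" if "I4 f = 0" "\<not> ?A 2"
    using that by (intro brank) (simp_all add: has_apolar_3_iff_I4)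
  moreover have "border_rank 6 f = 2" if "stable_sextic f" "?A 2"
    using that not1 by (intro brank) simp_all
  \<comment> \<open>Read contrapositively, this also excludes a quadratic annihilator in case
    (6).\<close>
  moreover have "I2 f ^ 3 + I6 f = 0 \<and> I2 f ^ 5 = I10 f" if "stable_sextic f" "?A 2"
    using stable_has_apolar_2[OF assms that] .
  moreover have "I2 f ^ 5 \<noteq> I10 f" if "stable_sextic f" "\<not> ?A 2" "I4 f = 0" "I2 f ^ 3 + I6 f = 0"
    using stable_not_has_apolar_2[OF assms that(1,2)] that(3,4) by (simp add: has_apolar_3_iff_I4)
  ultimately show ?thesis
    using one mult[of 6] mult[of 5] mult[of 4] mult[of 3] by auto
qed

end
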